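(* Let $\pi:R\to T$ be a surjective map of braided graded Hopf algebras which is an isomorphism in degree $0$, and assume that $R$ and $T$ are finite dimensional in each degree. Then the quotient $\eta(R,t)/\eta(T,t)$ of Hilbert series is again a series with nonnegative integer coefficients.
   Context: The base field $\mathbf k$ is arbitrary. A braided Hopf algebra is understood as a Hopf algebra in the braided category ${}^{K}_{K}\mathcal{YD}$ of left Yetter–Drinfel'd modules over a Hopf algebra $K$ with bijective antipode ($R$ and $T$ over the same $K$). It is graded if it is a direct sum $R=\bigoplus_{n\ge0}R_n$ of subobjects with all structure maps (product, unit, coproduct, counit, antipode) respecting the grading. A map of braided graded Hopf algebras is a degree-preserving morphism in the category ${}^{K}_{K}\mathcal{YD}$ which is an algebra and coalgebra map. The Hilbert series of a graded vector space $W=\bigoplus_{n\ge0}W_n$ with finite dimensional components is $\eta(W,t)=\sum_{n\ge0}(\dim W_n)t^n$. *)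

theory Defs
  imports
    "HOL-Library.Poly_Mapping"
    "HOL-Computational_Algebra.Formal_Power_Series"
begin

section \<open>Tensors\<close>

text \<open>
  Vector spaces are given by a scalar multiplication \<open>s :: 'k \<Rightarrow> 'v \<Rightarrow> 'v\<close> satisfying
  \<^const>\<open>vector_space\<close>. The tensor product of two spaces is the usual quotient of the free vector
  space \<open>'u \<times> 'v \<Rightarrow>\<^sub>0 'k\<close> by the subspace spanned by the bilinearity relations.
  Every tensor is a finite sum of pure tensors, so it is represented by a list of pairs:
  \<open>[(a\<^sub>1, b\<^sub>1), \<dots>, (a\<^sub>n, b\<^sub>n)]\<close> stands for the class of
  \<open>a\<^sub>1 \<otimes> b\<^sub>1 + \<dots> + a\<^sub>n \<otimes> b\<^sub>n\<close>, and two lists represent the same tensor iff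
  they are related by \<open>tensor_eq\<close>. A map into a tensor product is thus given by a choice of
  representatives; conditions on it are always stated up to \<open>tensor_eq\<close> (or after application of a
  linear map), and Sweedler notation becomes list comprehension.
\<close>

definition free_scale :: "'k::field \<Rightarrow> ('a \<Rightarrow>\<^sub>0 'k) \<Rightarrow> ('a \<Rightarrow>\<^sub>0 'k)" where
  "free_scale c = Poly_Mapping.map ((*) c)"

lemma lookup_free_scale [simp]:
  "Poly_Mapping.lookup (free_scale c f) a = c * Poly_Mapping.lookup f a"
  by (simp add: free_scale_def Poly_Mapping.map.rep_eq when_def)

lemma vector_space_free_scale: "vector_space (free_scale :: 'k::field \<Rightarrow> _)"
  by unfold_locales (auto intro!: poly_mapping_eqI simp: lookup_add algebra_simps)

abbreviation generator :: "'a \<Rightarrow> ('a \<Rightarrow>\<^sub>0 'k::field)" where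
  "generator a \<equiv> Poly_Mapping.single a 1"

definition formal_sum :: "'a list \<Rightarrow> ('a \<Rightarrow>\<^sub>0 'k::field)" where
  "formal_sum xs = (\<Sum>a\<leftarrow>xs. generator a)"

definition tensor_relations ::
  "('k::field \<Rightarrow> 'u::ab_group_add \<Rightarrow> 'u) \<Rightarrow> ('k \<Rightarrow> 'v::ab_group_add \<Rightarrow> 'v)
    \<Rightarrow> ('u \<times> 'v \<Rightarrow>\<^sub>0 'k) set" where
  "tensor_relations s t =
     {generator (a + a', b) - generator (a, b) - generator (a', b) | a a' b. True} \<union>
     {generator (a, b + b') - generator (a, b) - generator (a, b') | a b b'. True} \<union>
     {generator (s c a, b) - free_scale c (generator (a, b)) | c a b. True} \<union>
     {generator (a, t c b) - free_scale c (generator (a, b)) | c a b. True}"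

definition tensor_eq ::
  "('k::field \<Rightarrow> 'u::ab_group_add \<Rightarrow> 'u) \<Rightarrow> ('k \<Rightarrow> 'v::ab_group_add \<Rightarrow> 'v)
    \<Rightarrow> ('u \<times> 'v) list \<Rightarrow> ('u \<times> 'v) list \<Rightarrow> bool" where
  "tensor_eq s t xs ys \<longleftrightarrow>
     formal_sum xs - formal_sum ys \<in> module.span free_scale (tensor_relations s t)"

definition tensor3_relations ::
  "('k::field \<Rightarrow> 'u::ab_group_add \<Rightarrow> 'u) \<Rightarrow> ('k \<Rightarrow> 'v::ab_group_add \<Rightarrow> 'v)
    \<Rightarrow> ('k \<Rightarrow> 'w::ab_group_add \<Rightarrow> 'w) \<Rightarrow> ('u \<times> 'v \<times> 'w \<Rightarrow>\<^sub>0 'k) set" where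
  "tensor3_relations s t u =
     {generator (a + a', b, d) - generator (a, b, d) - generator (a', b, d) | a a' b d. True} \<union>
     {generator (a, b + b', d) - generator (a, b, d) - generator (a, b', d) | a b b' d. True} \<union>
     {generator (a, b, d + d') - generator (a, b, d) - generator (a, b, d') | a b d d'. True} \<union>
     {generator (s c a, b, d) - free_scale c (generator (a, b, d)) | c a b d. True} \<union>
     {generator (a, t c b, d) - free_scale c (generator (a, b, d)) | c a b d. True} \<union>
     {generator (a, b, u c d) - free_scale c (generator (a, b, d)) | c a b d. True}"

definition tensor3_eq ::
  "('k::field \<Rightarrow> 'u::ab_group_add \<Rightarrow> 'u) \<Rightarrow> ('k \<Rightarrow> 'v::ab_group_add \<Rightarrow> 'v)
    \<Rightarrow> ('k \<Rightarrow> 'w::ab_group_add \<Rightarrow> 'w)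
    \<Rightarrow> ('u \<times> 'v \<times> 'w) list \<Rightarrow> ('u \<times> 'v \<times> 'w) list \<Rightarrow> bool" where
  "tensor3_eq s t u xs ys \<longleftrightarrow>
     formal_sum xs - formal_sum ys \<in> module.span free_scale (tensor3_relations s t u)"

text \<open>Linearity of a map from the space of \<open>r\<close> to the tensor product of the spaces of \<open>s\<close> and \<open>t\<close>:\<close>

definition tensor_linear ::
  "('k::field \<Rightarrow> 'w::ab_group_add \<Rightarrow> 'w) \<Rightarrow> ('k \<Rightarrow> 'u::ab_group_add \<Rightarrow> 'u)
    \<Rightarrow> ('k \<Rightarrow> 'v::ab_group_add \<Rightarrow> 'v) \<Rightarrow> ('w \<Rightarrow> ('u \<times> 'v) list) \<Rightarrow> bool" where
  "tensor_linear r s t f \<longleftrightarrow>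
     (\<forall>x y. tensor_eq s t (f (x + y)) (f x @ f y)) \<and>
     (\<forall>c x. tensor_eq s t (f (r c x)) [(s c a, b). (a, b) \<leftarrow> f x])"


section \<open>Hopf algebras\<close>

record ('k, 'a) hopf_data =
  scalar :: "'k \<Rightarrow> 'a \<Rightarrow> 'a"  (infixr \<open>\<odot>\<index>\<close> 75)
  multiply :: "'a \<Rightarrow> 'a \<Rightarrow> 'a"  (infixl \<open>\<cdot>\<index>\<close> 70)
  unity :: 'a  (\<open>\<one>\<index>\<close>)
  comult :: "'a \<Rightarrow> ('a \<times> 'a) list"  (\<open>\<Delta>\<index>\<close>)
  counit :: "'a \<Rightarrow> 'k"  (\<open>\<epsilon>\<index>\<close>)
  antipode :: "'a \<Rightarrow> 'a"  (\<open>\<S>\<index>\<close>)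

locale unital_algebra =
  fixes A :: "('k::field, 'a::ab_group_add, 'm) hopf_data_scheme" (structure)
  assumes vector_space: "vector_space (scalar A)"
    and mult_linear_left: "Vector_Spaces.linear (scalar A) (scalar A) (\<lambda>x. x \<cdot> y)"
    and mult_linear_right: "Vector_Spaces.linear (scalar A) (scalar A) (\<lambda>y. x \<cdot> y)"
    and mult_assoc: "(x \<cdot> y) \<cdot> z = x \<cdot> (y \<cdot> z)"
    and mult_one_left: "\<one> \<cdot> x = x"
    and mult_one_right: "x \<cdot> \<one> = x"

locale counital_coalgebra =
  fixes A :: "('k::field, 'a::ab_group_add, 'm) hopf_data_scheme" (structure)
  assumes vector_space: "vector_space (scalar A)"
    and comult_linear: "tensor_linear (scalar A) (scalar A) (scalar A) \<Delta>"
    and counit_linear: "Vector_Spaces.linear (scalar A) (*) \<epsilon>"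
    and comult_coassoc: "tensor3_eq (scalar A) (scalar A) (scalar A)
      [(a, a', b). (x\<^sub>1, b) \<leftarrow> \<Delta> x, (a, a') \<leftarrow> \<Delta> x\<^sub>1] [(a, b, b'). (a, x\<^sub>2) \<leftarrow> \<Delta> x, (b, b') \<leftarrow> \<Delta> x\<^sub>2]"
    and counit_left: "(\<Sum>(a, b)\<leftarrow>\<Delta> x. \<epsilon> a \<odot> b) = x"
    and counit_right: "(\<Sum>(a, b)\<leftarrow>\<Delta> x. \<epsilon> b \<odot> a) = x"

text \<open>
  The antipode is a linear convolution inverse of the identity; this makes no reference to the
  braiding and is used both for ordinary and for braided Hopf algebras.
\<close>

locale algebra_coalgebra_antipode = unital_algebra A + counital_coalgebra A
  for A :: "('k::field, 'a::ab_group_add, 'm) hopf_data_scheme" (structure) +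
  assumes antipode_linear: "Vector_Spaces.linear (scalar A) (scalar A) \<S>"
    and antipode_left: "(\<Sum>(a, b)\<leftarrow>\<Delta> x. \<S> a \<cdot> b) = \<epsilon> x \<odot> \<one>"
    and antipode_right: "(\<Sum>(a, b)\<leftarrow>\<Delta> x. a \<cdot> \<S> b) = \<epsilon> x \<odot> \<one>"

locale hopf_algebra = algebra_coalgebra_antipode A
  for A :: "('k::field, 'a::ab_group_add, 'm) hopf_data_scheme" (structure) +
  assumes comult_mult: "tensor_eq (scalar A) (scalar A)
      (\<Delta> (x \<cdot> y)) [(a \<cdot> c, b \<cdot> d). (a, b) \<leftarrow> \<Delta> x, (c, d) \<leftarrow> \<Delta> y]"
    and comult_one: "tensor_eq (scalar A) (scalar A) (\<Delta> \<one>) [(\<one>, \<one>)]"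
    and counit_mult: "\<epsilon> (x \<cdot> y) = \<epsilon> x * \<epsilon> y"
    and counit_one: "\<epsilon> \<one> = 1"


section \<open>Yetter--Drinfeld modules\<close>

locale yetter_drinfeld_module = K: hopf_algebra K
  for K :: "('k::field, 'h::ab_group_add, 'm) hopf_data_scheme" (structure)
    and s :: "'k \<Rightarrow> 'v::ab_group_add \<Rightarrow> 'v"
    and act :: "'h \<Rightarrow> 'v \<Rightarrow> 'v"  (infixr \<open>\<triangleright>\<close> 75)
    and coact :: "'v \<Rightarrow> ('h \<times> 'v) list"  (\<open>\<delta>\<close>) +
  assumes vector_space: "vector_space s"
    and act_linear_left: "Vector_Spaces.linear (scalar K) s (\<lambda>h. h \<triangleright> v)"
    and act_linear_right: "Vector_Spaces.linear s s (\<lambda>v. h \<triangleright> v)"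
    and act_mult: "(g \<cdot> h) \<triangleright> v = g \<triangleright> h \<triangleright> v"
    and act_one: "\<one> \<triangleright> v = v"
    and coact_linear: "tensor_linear s (scalar K) s \<delta>"
    and coact_coassoc: "tensor3_eq (scalar K) (scalar K) s
      [(g\<^sub>1, g\<^sub>2, w). (g, w) \<leftarrow> \<delta> v, (g\<^sub>1, g\<^sub>2) \<leftarrow> \<Delta> g] [(g, h, u). (g, w) \<leftarrow> \<delta> v, (h, u) \<leftarrow> \<delta> w]"
    and coact_counit: "(\<Sum>(g, w)\<leftarrow>\<delta> v. s (\<epsilon> g) w) = v"
    and compatibility: "tensor_eq (scalar K) s (\<delta> (h \<triangleright> v))
      [(h\<^sub>1 \<cdot> g \<cdot> \<S> h\<^sub>3, h\<^sub>2 \<triangleright> w). (h\<^sub>1, h') \<leftarrow> \<Delta> h, (h\<^sub>2, h\<^sub>3) \<leftarrow> \<Delta> h', (g, w) \<leftarrow> \<delta> v]"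


section \<open>Graded braided Hopf algebras\<close>

record ('k, 'h, 'a) graded_yd_hopf_data = "('k, 'a) hopf_data" +
  action :: "'h \<Rightarrow> 'a \<Rightarrow> 'a"  (infixr \<open>\<triangleright>\<index>\<close> 75)
  coaction :: "'a \<Rightarrow> ('h \<times> 'a) list"  (\<open>\<delta>\<index>\<close>)
  component :: "nat \<Rightarrow> 'a set"

text \<open>
  A Hopf algebra in the category of Yetter--Drinfeld modules over \<open>K\<close>. All structure maps are
  linear and colinear over \<open>K\<close>, where the tensor square carries the diagonal action and coaction and
  the ground field the trivial ones. The comultiplication is multiplicative with respect to the
  product of the braided tensor square, which is formed with the braiding
  \<open>x \<otimes> y \<mapsto> x\<^sub>(\<^sub>-\<^sub>1\<^sub>) \<triangleright> y \<otimes> x\<^sub>(\<^sub>0\<^sub>)\<close>.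
\<close>

locale braided_hopf_algebra =
  algebra_coalgebra_antipode R +
  yetter_drinfeld_module K "scalar R" "action R" "coaction R"
  for K :: "('k::field, 'h::ab_group_add, 'm) hopf_data_scheme"
    and R :: "('k, 'h, 'a::ab_group_add, 'n) graded_yd_hopf_data_scheme" (structure) +
  assumes mult_act: "h \<triangleright> (x \<cdot> y) = (\<Sum>(h\<^sub>1, h\<^sub>2)\<leftarrow>\<Delta>\<^bsub>K\<^esub> h. (h\<^sub>1 \<triangleright> x) \<cdot> (h\<^sub>2 \<triangleright> y))"
    and mult_coact: "tensor_eq (scalar K) (scalar R) (\<delta> (x \<cdot> y))
      [(g \<cdot>\<^bsub>K\<^esub> h, a \<cdot> b). (g, a) \<leftarrow> \<delta> x, (h, b) \<leftarrow> \<delta> y]"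
    and one_act: "h \<triangleright> \<one> = \<epsilon>\<^bsub>K\<^esub> h \<odot> \<one>"
    and one_coact: "tensor_eq (scalar K) (scalar R) (\<delta> \<one>) [(\<one>\<^bsub>K\<^esub>, \<one>)]"
    and comult_act: "tensor_eq (scalar R) (scalar R) (\<Delta> (h \<triangleright> x))
      [(h\<^sub>1 \<triangleright> a, h\<^sub>2 \<triangleright> b). (h\<^sub>1, h\<^sub>2) \<leftarrow> \<Delta>\<^bsub>K\<^esub> h, (a, b) \<leftarrow> \<Delta> x]"
    and comult_coact: "tensor3_eq (scalar K) (scalar R) (scalar R)
      [(g, a, b). (g, y) \<leftarrow> \<delta> x, (a, b) \<leftarrow> \<Delta> y]
      [(g \<cdot>\<^bsub>K\<^esub> h, a\<^sub>0, b\<^sub>0). (a, b) \<leftarrow> \<Delta> x, (g, a\<^sub>0) \<leftarrow> \<delta> a, (h, b\<^sub>0) \<leftarrow> \<delta> b]"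
    and counit_act: "\<epsilon> (h \<triangleright> x) = \<epsilon>\<^bsub>K\<^esub> h * \<epsilon> x"
    and counit_coact: "(\<Sum>(g, y)\<leftarrow>\<delta> x. \<epsilon> y \<odot>\<^bsub>K\<^esub> g) = \<epsilon> x \<odot>\<^bsub>K\<^esub> \<one>\<^bsub>K\<^esub>"
    and antipode_act: "\<S> (h \<triangleright> x) = h \<triangleright> \<S> x"
    and antipode_coact: "tensor_eq (scalar K) (scalar R) (\<delta> (\<S> x)) [(g, \<S> y). (g, y) \<leftarrow> \<delta> x]"
    and comult_mult: "tensor_eq (scalar R) (scalar R) (\<Delta> (x \<cdot> y))
      [(x\<^sub>1 \<cdot> (g \<triangleright> y\<^sub>1), x\<^sub>2\<^sub>0 \<cdot> y\<^sub>2). (x\<^sub>1, x\<^sub>2) \<leftarrow> \<Delta> x, (y\<^sub>1, y\<^sub>2) \<leftarrow> \<Delta> y, (g, x\<^sub>2\<^sub>0) \<leftarrow> \<delta> x\<^sub>2]"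
    and comult_one: "tensor_eq (scalar R) (scalar R) (\<Delta> \<one>) [(\<one>, \<one>)]"
    and counit_mult: "\<epsilon> (x \<cdot> y) = \<epsilon> x * \<epsilon> y"
    and counit_one: "\<epsilon> \<one> = 1"

text \<open>
  Since tensors are only given up to \<^const>\<open>tensor_eq\<close>, membership of a tensor in (the image of) a
  sum of tensor products of subspaces means that it has a representative of the required form.
\<close>

locale graded_braided_hopf_algebra = braided_hopf_algebra K R
  for K :: "('k::field, 'h::ab_group_add, 'm) hopf_data_scheme"
    and R :: "('k, 'h, 'a::ab_group_add, 'n) graded_yd_hopf_data_scheme" (structure) +
  assumes component_subspace: "module.subspace (scalar R) (component R n)"
    and component_act: "x \<in> component R n \<Longrightarrow> h \<triangleright> x \<in> component R n"
    and component_coact: "x \<in> component R n \<Longrightarrow>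
      \<exists>zs. tensor_eq (scalar K) (scalar R) (\<delta> x) zs \<and> (\<forall>(g, y)\<in>set zs. y \<in> component R n)"
    and direct_sum: "\<exists>!f. (\<forall>n. f n \<in> component R n) \<and> finite {n. f n \<noteq> 0} \<and>
      x = (\<Sum>n | f n \<noteq> 0. f n)"
    and component_mult: "x \<in> component R m \<Longrightarrow> y \<in> component R n \<Longrightarrow> x \<cdot> y \<in> component R (m + n)"
    and component_one: "\<one> \<in> component R 0"
    and component_comult: "x \<in> component R n \<Longrightarrow>
      \<exists>zs. tensor_eq (scalar R) (scalar R) (\<Delta> x) zs \<and>
        (\<forall>(a, b)\<in>set zs. \<exists>i j. i + j = n \<and> a \<in> component R i \<and> b \<in> component R j)"
    and component_counit: "x \<in> component R n \<Longrightarrow> n > 0 \<Longrightarrow> \<epsilon> x = 0"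
    and component_antipode: "x \<in> component R n \<Longrightarrow> \<S> x \<in> component R n"

locale graded_braided_hopf_map =
  R: graded_braided_hopf_algebra K R + T: graded_braided_hopf_algebra K T
  for K :: "('k::field, 'h::ab_group_add, 'm) hopf_data_scheme"
    and R :: "('k, 'h, 'a::ab_group_add, 'n) graded_yd_hopf_data_scheme"
    and T :: "('k, 'h, 'b::ab_group_add, 'o) graded_yd_hopf_data_scheme" +
  fixes \<pi> :: "'a \<Rightarrow> 'b"
  assumes map_linear: "Vector_Spaces.linear (scalar R) (scalar T) \<pi>"
    and map_act: "\<pi> (h \<triangleright>\<^bsub>R\<^esub> x) = h \<triangleright>\<^bsub>T\<^esub> \<pi> x"
    and map_coact: "tensor_eq (scalar K) (scalar T)
      (\<delta>\<^bsub>T\<^esub> (\<pi> x)) [(g, \<pi> y). (g, y) \<leftarrow> \<delta>\<^bsub>R\<^esub> x]"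
    and map_mult: "\<pi> (x \<cdot>\<^bsub>R\<^esub> y) = \<pi> x \<cdot>\<^bsub>T\<^esub> \<pi> y"
    and map_one: "\<pi> \<one>\<^bsub>R\<^esub> = \<one>\<^bsub>T\<^esub>"
    and map_comult: "tensor_eq (scalar T) (scalar T)
      (\<Delta>\<^bsub>T\<^esub> (\<pi> x)) [(\<pi> a, \<pi> b). (a, b) \<leftarrow> \<Delta>\<^bsub>R\<^esub> x]"
    and map_counit: "\<epsilon>\<^bsub>T\<^esub> (\<pi> x) = \<epsilon>\<^bsub>R\<^esub> x"
    and map_component: "x \<in> component R n \<Longrightarrow> \<pi> x \<in> component T n"


section \<open>Hilbert series\<close>

definition locally_finite ::
  "('k::field, 'h, 'a::ab_group_add, 'n) graded_yd_hopf_data_scheme \<Rightarrow> bool" where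
  "locally_finite R \<longleftrightarrow>
     (\<forall>n. \<exists>B. finite B \<and> B \<subseteq> component R n \<and> component R n \<subseteq> module.span (scalar R) B)"

text \<open>
  Coefficients are taken in \<^typ>\<open>rat\<close>, so that a Hilbert series with nonzero constant term is
  invertible and the quotient of two Hilbert series is a quotient of power series.
\<close>

definition hilbert_series ::
  "('k::field, 'h, 'a::ab_group_add, 'n) graded_yd_hopf_data_scheme \<Rightarrow> rat fps" where
  "hilbert_series R = Abs_fps (\<lambda>n. of_nat (vector_space.dim (scalar R) (component R n)))"

end

theory Submission
  imports Defs
begin

text \<open>
  Through \<open>\<pi>\<close>, the algebra \<open>R\<close> is a right comodule over \<open>T\<close>, by \<open>x \<mapsto> x\<^sub>1 \<otimes> \<pi> x\<^sub>2\<close>. Let \<open>F d\<close>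
  be the largest subcomodule contained in \<open>R\<^sub>\<ge>\<^sub>d = \<Oplus>\<^sub>n\<^sub>\<ge>\<^sub>d R\<^sub>n\<close>, that is, the set of all \<open>x\<close>
  with \<open>x\<^sub>1 \<otimes> \<pi> x\<^sub>2 \<in> R\<^sub>\<ge>\<^sub>d \<otimes> T\<close>. These subcomodules are graded right ideals, they decrease
  from \<open>F 0 = R\<close>, and \<open>F d\<close> vanishes below degree \<open>d\<close>. The theorem follows once
  \<open>F d / F (d + 1)\<close> is isomorphic to \<open>V d \<otimes> T\<close> for a vector space \<open>V d\<close> placed in degree
  \<open>d\<close>: then \<open>dim V d\<close> is the \<open>d\<close>-th coefficient of the quotient.

  The space \<open>V d\<close> is found as in the fundamental theorem of Hopf modules, applied to the lowest
  component \<open>F d \<inter> R\<^sub>d\<close>, which is a Hopf module over \<open>R\<^sub>0 \<cong> T\<^sub>0\<close>. Let \<open>p\<close> be the projection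
  of \<open>R\<close> onto \<open>R\<^sub>0\<close> and let \<open>E x = x\<^sub>1 S(p x\<^sub>2)\<close> (\<open>coinv\<close> below), the usual map onto
  coinvariants. It satisfies \<open>E (x y) = \<epsilon> y E x\<close> for \<open>y \<in> R\<^sub>0\<close>, and
  \<open>x = E(x\<^sub>1) p(x\<^sub>2)\<close>. Put \<open>V d = E (F d \<inter> R\<^sub>d)\<close>. The isomorphism is induced by
  \<open>f x = E (pr\<^sub>d x\<^sub>1) \<otimes> \<pi> x\<^sub>2\<close>, where \<open>pr\<^sub>d\<close> is the projection onto \<open>R\<^sub>d\<close>:

  \<^item> its kernel in \<open>F d\<close> is \<open>F (d + 1)\<close>, because \<open>x = E(x\<^sub>1) p(x\<^sub>2)\<close> recovers
    \<open>pr\<^sub>d x\<^sub>1 \<otimes> \<pi> x\<^sub>2\<close> from \<open>f x\<close> (lemma \<open>pr_hit_eq_0\<close>);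
  \<^item> it maps \<open>F d\<close> onto \<open>V d \<otimes> T\<close>, because \<open>f (x z) = f x (1 \<otimes> \<pi> z)\<close> (lemma
    \<open>coinv_hit_mult\<close>), hence \<open>f (E u z) = E u \<otimes> \<pi> z\<close> (lemma \<open>coinv_hit_coinv_mult\<close>), and
    \<open>\<pi>\<close> is surjective.

  The braiding enters only through the product rule for the comultiplication. In
  \<open>\<Delta> (x y) = x\<^sub>1 (x\<^sub>2\<^sub>(\<^sub>-\<^sub>1\<^sub>) \<triangleright> y\<^sub>1) \<otimes> x\<^sub>2\<^sub>(\<^sub>0\<^sub>) y\<^sub>2\<close> the twisted factor stands next to
  \<open>x\<^sub>1\<close>; after projection to the lowest degree it lies in \<open>R\<^sub>0\<close>, so that \<open>E\<close> turns it into a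
  scalar by the counit, and the counit is invariant under the action of \<open>K\<close>. For the identity
  \<open>E (x y) = \<epsilon> y E x\<close> itself, a convolution argument replaces the anti-multiplicativity of
  the antipode (lemma \<open>contract_act_antipode\<close>).

  Tensors are treated through their values under multilinear maps. In particular \<open>x\<^sub>1 \<otimes> \<pi> x\<^sub>2\<close>
  is replaced by the family of the vectors \<open>\<phi>(\<pi> x\<^sub>2) x\<^sub>1\<close> with \<open>\<phi>\<close> ranging over the linear
  functionals on \<open>T\<close> (\<open>hit \<phi> x\<close> below).
\<close>

section \<open>Linear algebra\<close>

lemma linearI:
  assumes "vector_space s" "vector_space w"
    and "\<And>x y. f (x + y) = f x + f y" "\<And>c x. f (s c x) = w c (f x)"
  shows "Vector_Spaces.linear s w f"
  using assms by (simp add: Vector_Spaces.linear_iff)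

lemma linear_add: "Vector_Spaces.linear s w f \<Longrightarrow> f (x + y) = f x + f y"
  and linear_scale: "Vector_Spaces.linear s w f \<Longrightarrow> f (s c x) = w c (f x)"
  and linear_vector_space2: "Vector_Spaces.linear s w f \<Longrightarrow> vector_space w"
  by (simp_all add: Vector_Spaces.linear_iff)

lemma linear_zero: "Vector_Spaces.linear s w f \<Longrightarrow> f 0 = 0"
  using linear_add[of s w f 0 0] by simp

lemma linear_sum: "Vector_Spaces.linear s w f \<Longrightarrow> f (sum g A) = (\<Sum>x\<in>A. f (g x))"
  by (induction A rule: infinite_finite_induct) (simp_all add: linear_zero linear_add)

lemma linear_compose:
  "Vector_Spaces.linear s w f \<Longrightarrow> Vector_Spaces.linear w u g \<Longrightarrow> Vector_Spaces.linear s u (\<lambda>x. g (f x))"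
  by (simp add: Vector_Spaces.linear_iff)

lemma vector_space_field: "vector_space ((*) :: 'k::field \<Rightarrow> 'k \<Rightarrow> 'k)"
  by unfold_locales (auto simp: algebra_simps)

text \<open>
  Rank-nullity for a linear map on a finite-dimensional subspace of a space of any dimension.
\<close>
lemma dim_kernel_image:
  fixes s :: "'k::field \<Rightarrow> 'a::ab_group_add \<Rightarrow> 'a" and w :: "'k \<Rightarrow> 'b::ab_group_add \<Rightarrow> 'b"
  assumes f: "Vector_Spaces.linear s w f"
    and G: "module.subspace s G" and fin: "finite X" "G \<subseteq> module.span s X"
  shows "vector_space.dim s G = vector_space.dim s {x \<in> G. f x = 0} + vector_space.dim w (f ` G)"
proof -
  interpret f: Vector_Spaces.linear s w f by (rule f)
  define N where "N = {x \<in> G. f x = 0}"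
  obtain A where A: "A \<subseteq> N" "f.vs1.independent A" "N \<subseteq> f.vs1.span A" "card A = f.vs1.dim N"
    by (rule f.vs1.basis_exists)
  have "A \<subseteq> G" using A(1) by (auto simp: N_def)
  then obtain B where B: "A \<subseteq> B" "B \<subseteq> G" "f.vs1.independent B" "G \<subseteq> f.vs1.span B"
    using f.vs1.maximal_independent_subset_extend[OF _ A(2)] by metis
  have finB: "finite B"
    using f.vs1.independent_span_bound[OF fin(1) B(3)] B(2) fin(2) by auto
  have spanB: "f.vs1.span B \<subseteq> G" using B(2) G by (rule f.vs1.span_minimal)
  have indep: "f.vs1.independent (B - A)" using B(3) f.vs1.independent_mono by blast
  \<comment> \<open>A basis \<open>A\<close> of the kernel extends to a basis \<open>B\<close> of \<open>G\<close>, and \<open>f\<close> is injective on the span of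
    the rest, which meets the kernel trivially by uniqueness of coordinates.\<close>
  have "x = 0" if x: "x \<in> f.vs1.span (B - A)" and fx: "f x = 0" for x
  proof -
    have "x \<in> f.vs1.span B" using x f.vs1.span_mono[of "B - A" B] by auto
    hence "x \<in> f.vs1.span A" using fx spanB A(3) by (auto simp: N_def)
    hence "f.vs1.representation B x = f.vs1.representation A x"
      using B by (intro f.vs1.representation_extend)
    moreover have "f.vs1.representation B x = f.vs1.representation (B - A) x"
      using B x by (intro f.vs1.representation_extend) auto
    moreover have "f.vs1.representation A x b = 0 \<or> f.vs1.representation (B - A) x b = 0" for b
      using f.vs1.representation_ne_zero[of A x b] f.vs1.representation_ne_zero[of "B - A" x b] by blast
    ultimately have "f.vs1.representation B x b = 0" for b by metis
    thus "x = 0"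
      using f.vs1.sum_nonzero_representation_eq[OF B(3) \<open>x \<in> f.vs1.span B\<close>] by simp
  qed
  hence inj: "inj_on f (f.vs1.span (B - A))"
    by (simp add: f.inj_on_iff_eq_0)
  hence "f.vs2.independent (f ` (B - A))" using indep f.independent_injective_image by blast
  moreover have "f ` G \<subseteq> f.vs2.span (f ` (B - A))"
  proof -
    have "f ` G \<subseteq> f.vs2.span (f ` B)" using B(4) by (auto simp: f.span_image)
    moreover have "f ` B \<subseteq> insert 0 (f ` (B - A))" using A(1) by (auto simp: N_def)
    hence "f.vs2.span (f ` B) \<subseteq> f.vs2.span (f ` (B - A))"
      using f.vs2.span_mono[of "f ` B" "insert 0 (f ` (B - A))"] by simp
    ultimately show ?thesis by blast
  qed
  moreover have "f ` (B - A) \<subseteq> f ` G" using B by auto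
  ultimately have "f.vs2.dim (f ` G) = card (f ` (B - A))"
    using f.vs2.dim_unique by blast
  also have "\<dots> = card (B - A)"
    using inj f.vs1.span_superset inj_on_subset by (intro card_image) blast
  finally show ?thesis
    using A(4) B f.vs1.dim_unique[of B G] finB finite_subset[OF B(1) finB] card_mono[OF finB B(1)]
    by (simp add: N_def[symmetric] card_Diff_subset)
qed

text \<open>
  The maps \<open>f b\<close> together map \<open>G\<close> to the direct sum of \<open>card B\<close> copies of \<open>V\<close>, and the last
  hypothesis makes this map surjective. Imposing the equations \<open>f b x = 0\<close> one after the other
  avoids forming the direct sum: each of them lowers the dimension by that of \<open>V\<close>.
\<close>
lemma dim_joint_kernel:
  fixes s :: "'k::field \<Rightarrow> 'a::ab_group_add \<Rightarrow> 'a" and w :: "'k \<Rightarrow> 'b::ab_group_add \<Rightarrow> 'b"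
  assumes "finite B" and lin: "\<And>b. b \<in> B \<Longrightarrow> Vector_Spaces.linear s w (f b)"
    and vs: "vector_space s"
    and G: "module.subspace s G" and fin: "finite X" "G \<subseteq> module.span s X"
    and range: "\<And>b x. b \<in> B \<Longrightarrow> x \<in> G \<Longrightarrow> f b x \<in> V"
    and onto: "\<And>b v. b \<in> B \<Longrightarrow> v \<in> V \<Longrightarrow> \<exists>x\<in>G. f b x = v \<and> (\<forall>b'\<in>B - {b}. f b' x = 0)"
  shows "vector_space.dim s G
    = vector_space.dim s {x \<in> G. \<forall>b\<in>B. f b x = 0} + card B * vector_space.dim w V"
proof -
  interpret vector_space s by (rule vs)
  have "dim G = dim {x \<in> G. \<forall>b\<in>S. f b x = 0} + card S * vector_space.dim w V"
    if "finite S" "S \<subseteq> B" for S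
    using that
  proof (induction S)
    case (insert c S)
    let ?H = "{x \<in> G. \<forall>b\<in>S. f b x = 0}"
    have 1: "dim ?H = dim {x \<in> ?H. f c x = 0} + vector_space.dim w (f c ` ?H)"
    proof (rule dim_kernel_image[OF _ _ fin(1)])
      show "Vector_Spaces.linear s w (f c)" using insert lin by simp
      show "subspace ?H"
      proof (rule subspaceI)
        show "0 \<in> ?H" using insert.prems subspace_0[OF G] by (auto simp: linear_zero[OF lin] subset_iff)
        show "x + y \<in> ?H" if "x \<in> ?H" "y \<in> ?H" for x y
          using insert.prems that subspace_add[OF G] by (auto simp: linear_add[OF lin] subset_iff)
        show "s a x \<in> ?H" if "x \<in> ?H" for a x
        proof -
          have "f b (s a x) = 0" if "b \<in> S" for b
            using that \<open>x \<in> ?H\<close> insert.prems linear_scale[OF lin, of b a x] linear_vector_space2[OF lin, of b]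
            by (auto simp: subset_iff module.scale_zero_right module_iff_vector_space)
          thus ?thesis using that subspace_scale[OF G] by auto
        qed
      qed
      show "?H \<subseteq> span X" using fin by auto
    qed
    have "f c ` ?H = V"
    proof
      show "f c ` ?H \<subseteq> V" using range insert.prems by auto
      show "V \<subseteq> f c ` ?H"
      proof
        fix v assume "v \<in> V"
        then obtain x where "x \<in> G" "f c x = v" "\<forall>b'\<in>B - {c}. f b' x = 0"
          using onto insert.prems by blast
        thus "v \<in> f c ` ?H" using insert by (intro image_eqI[of _ _ x]) auto
      qed
    qed
    moreover have "{x \<in> ?H. f c x = 0} = {x \<in> G. \<forall>b\<in>insert c S. f b x = 0}" by auto
    ultimately show ?case using 1 insert by (simp add: algebra_simps)
  qed simp
  from this[OF assms(1) order.refl] show ?thesis .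
qed

text \<open>
  Finitely many vectors lie in the span of finitely many members of a basis of the whole space,
  and \<open>\<chi> b\<close> can be taken to be the coordinate belonging to \<open>b\<close>.
\<close>
lemma finite_dual_system:
  fixes s :: "'k::field \<Rightarrow> 'a::ab_group_add \<Rightarrow> 'a"
  assumes "vector_space s" and "finite X"
  obtains I \<chi> where "finite I" "\<And>b. Vector_Spaces.linear s (*) (\<chi> b)"
    "\<And>x. x \<in> X \<Longrightarrow> x = (\<Sum>b\<in>I. s (\<chi> b x) b)"
proof -
  interpret vector_space s by fact
  define B where "B = extend_basis {}"
  have B: "independent B" "span B = UNIV" 
    unfolding B_def by (intro independent_extend_basis span_extend_basis independent_empty)+
  define I where "I = (\<Union>x\<in>X. {b. representation B x b \<noteq> 0})"
  show thesis
  proof (rule that[of I "\<lambda>b x. representation B x b"])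
    show "finite I" using assms(2) by (simp add: I_def finite_representation)
    show "Vector_Spaces.linear s (*) (\<lambda>x. representation B x b)" for b
      using B by (intro linearI vector_space_axioms vector_space_field)
        (simp_all add: representation_add representation_scale)
    fix x assume "x \<in> X"
    have "x = (\<Sum>b | representation B x b \<noteq> 0. s (representation B x b) b)"
      using B by (simp add: sum_nonzero_representation_eq)
    also have "\<dots> = (\<Sum>b\<in>I. s (representation B x b) b)"
      using \<open>finite I\<close> \<open>x \<in> X\<close> by (intro sum.mono_neutral_left) (auto simp: I_def)
    finally show "x = (\<Sum>b\<in>I. s (representation B x b) b)" .
  qed
qed

lemma basis_dual_system:
  fixes s :: "'k::field \<Rightarrow> 'a::ab_group_add \<Rightarrow> 'a"
  assumes "vector_space s" and "finite X" "V \<subseteq> module.span s X"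
  obtains B \<chi> where "finite B" "B \<subseteq> V" "card B = vector_space.dim s V"
    "\<And>b. Vector_Spaces.linear s (*) (\<chi> b)"
    "\<And>b b'. b \<in> B \<Longrightarrow> b' \<in> B \<Longrightarrow> \<chi> b b' = (if b = b' then 1 else 0)"
    "\<And>x. x \<in> V \<Longrightarrow> x = (\<Sum>b\<in>B. s (\<chi> b x) b)"
proof -
  interpret vector_space s by fact
  obtain B where B: "B \<subseteq> V" "independent B" "V \<subseteq> span B" "card B = dim V"
    by (rule basis_exists)
  have fin: "finite B" using independent_span_bound[OF assms(2) B(2)] B(1) assms(3) by auto
  define E where "E = extend_basis B"
  have E: "independent E" "span E = UNIV" "B \<subseteq> E"
    using B(2) by (simp_all add: E_def independent_extend_basis extend_basis_superset)
  show thesis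
  proof (rule that[of B "\<lambda>b x. representation E x b"])
    show "Vector_Spaces.linear s (*) (\<lambda>x. representation E x b)" for b
      using E by (intro linearI vector_space_axioms vector_space_field)
        (simp_all add: representation_add representation_scale)
    show "representation E b' b = (if b = b' then 1 else 0)" if "b \<in> B" "b' \<in> B" for b b'
      using E that by (auto simp: representation_basis subset_iff)
    fix x assume "x \<in> V"
    hence x: "x \<in> span B" using B by auto
    have "representation E x = representation B x"
      using E x by (intro representation_extend) auto
    thus "x = (\<Sum>b\<in>B. s (representation E x b) b)"
      using sum_representation_eq[OF B(2) x fin order.refl] by simp
  qed (use B fin in auto)
qed

section \<open>Evaluating tensors\<close>

text \<open>
  A map that is linear in each argument has a well-defined value on a tensor, the sum of its
  values on the pure tensors of any representative. With \<open>contract (\<Delta> x) (\<lambda>a b. \<dots>)\<close> these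
  values read like Sweedler notation.
\<close>
definition contract :: "('a \<times> 'b) list \<Rightarrow> ('a \<Rightarrow> 'b \<Rightarrow> 'w::comm_monoid_add) \<Rightarrow> 'w" where
  "contract xs B = (\<Sum>(a, b)\<leftarrow>xs. B a b)"

definition contract3 :: "('a \<times> 'b \<times> 'c) list \<Rightarrow> ('a \<Rightarrow> 'b \<Rightarrow> 'c \<Rightarrow> 'w::comm_monoid_add) \<Rightarrow> 'w" where
  "contract3 xs B = (\<Sum>(a, b, c)\<leftarrow>xs. B a b c)"

lemma contract_Nil [simp]: "contract [] B = 0"
  and contract_Cons [simp]: "contract ((a, b) # xs) B = B a b + contract xs B"
  and contract_append [simp]: "contract (xs @ ys) B = contract xs B + contract ys B"
  by (simp_all add: contract_def)

lemma contract_map: "contract (map (\<lambda>(a, b). (F a b, G a b)) xs) B = contract xs (\<lambda>a b. B (F a b) (G a b))"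
  by (simp add: contract_def split_def comp_def)

lemma sum_list_concat_map: "sum_list (map f (concat xss)) = (\<Sum>xs\<leftarrow>xss. sum_list (map f xs))"
  by (induction xss) simp_all

lemma contract_concat:
  "contract (concat (map (\<lambda>(a, b). H a b) xs)) B = contract xs (\<lambda>a b. contract (H a b) B)"
  by (simp add: contract_def split_def comp_def sum_list_concat_map)

lemma contract3_concat:
  "contract3 (concat (map (\<lambda>(a, b). H a b) xs)) B = contract xs (\<lambda>a b. contract3 (H a b) B)"
  by (simp add: contract_def contract3_def split_def comp_def sum_list_concat_map)

lemma contract3_map:
  "contract3 (map (\<lambda>(a, b). (F a b, G a b, H a b)) xs) B = contract xs (\<lambda>a b. B (F a b) (G a b) (H a b))"
  by (simp add: contract_def contract3_def split_def comp_def)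

lemma contract3_map_Pair: "contract3 (map (Pair a) xs) B = contract xs (B a)"
  by (simp add: contract_def contract3_def split_def comp_def)

lemma contract_cong:
  "(\<And>a b. (a, b) \<in> set xs \<Longrightarrow> B a b = C a b) \<Longrightarrow> contract xs B = contract xs C"
  by (induction xs) (auto simp: contract_def)

lemma contract_zero [simp]: "contract xs (\<lambda>a b. 0) = 0"
  by (induction xs) (auto simp: contract_def)

lemma contract_add: "contract xs (\<lambda>a b. B a b + C a b) = contract xs B + contract xs C"
  by (induction xs) (auto simp: algebra_simps)

lemma contract_sum: "contract xs (\<lambda>a b. \<Sum>i\<in>I. B i a b) = (\<Sum>i\<in>I. contract xs (B i))"
  by (induction xs) (auto simp: sum.distrib)

lemma contract_swap:
  "contract xs (\<lambda>a b. contract ys (\<lambda>c d. B a b c d)) = contract ys (\<lambda>c d. contract xs (\<lambda>a b. B a b c d))"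
  by (induction xs) (auto simp: contract_add)

lemma linear_contract:
  "Vector_Spaces.linear s w f \<Longrightarrow> f (contract xs B) = contract xs (\<lambda>a b. f (B a b))"
  by (induction xs) (auto simp: linear_zero linear_add)

lemma contract_scale: "vector_space w \<Longrightarrow> contract xs (\<lambda>a b. w c (B a b)) = w c (contract xs B)"
  by (induction xs)
    (auto simp: module.scale_zero_right module.scale_right_distrib module_iff_vector_space)

lemma linear_contract_pointwise:
  assumes "vector_space s" "vector_space w" "\<And>a b. Vector_Spaces.linear s w (F a b)"
  shows "Vector_Spaces.linear s w (\<lambda>x. contract xs (\<lambda>a b. F a b x))"
  by (rule linearI[OF assms(1,2)])
    (simp_all add: linear_add[OF assms(3)] linear_scale[OF assms(3)] contract_add contract_scale[OF assms(2)])

definition bilinear_map ::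
  "('k::field \<Rightarrow> 'u::ab_group_add \<Rightarrow> 'u) \<Rightarrow> ('k \<Rightarrow> 'v::ab_group_add \<Rightarrow> 'v)
    \<Rightarrow> ('k \<Rightarrow> 'w::ab_group_add \<Rightarrow> 'w) \<Rightarrow> ('u \<Rightarrow> 'v \<Rightarrow> 'w) \<Rightarrow> bool" where
  "bilinear_map s t w B \<longleftrightarrow>
     (\<forall>b. Vector_Spaces.linear s w (\<lambda>a. B a b)) \<and> (\<forall>a. Vector_Spaces.linear t w (\<lambda>b. B a b))"

lemma bilinear_mapI:
  assumes "vector_space s" "vector_space t" "vector_space w"
    and "\<And>a a' b. B (a + a') b = B a b + B a' b" "\<And>a b b'. B a (b + b') = B a b + B a b'"
    and "\<And>c a b. B (s c a) b = w c (B a b)" "\<And>c a b. B a (t c b) = w c (B a b)"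
  shows "bilinear_map s t w B"
  using assms by (simp add: bilinear_map_def Vector_Spaces.linear_iff)

lemma
  assumes "bilinear_map s t w B"
  shows bilinear_map_left: "Vector_Spaces.linear s w (\<lambda>a. B a b)"
    and bilinear_map_right: "Vector_Spaces.linear t w (\<lambda>b. B a b)"
  using assms by (simp_all add: bilinear_map_def)

text \<open>
  The linear extension of a map on generators to the free vector space. Tensor relations are
  differences on which the extension of a multilinear map vanishes.
\<close>
definition extend :: "('k::field \<Rightarrow> 'w::ab_group_add \<Rightarrow> 'w) \<Rightarrow> ('a \<Rightarrow> 'w) \<Rightarrow> ('a \<Rightarrow>\<^sub>0 'k) \<Rightarrow> 'w" where
  "extend w g f = (\<Sum>a\<in>Poly_Mapping.keys f. w (Poly_Mapping.lookup f a) (g a))"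

context
  fixes w :: "'k::field \<Rightarrow> 'w::ab_group_add \<Rightarrow> 'w"
  assumes w: "vector_space w"
begin

interpretation vector_space w by (rule w)

lemma extend_superset:
  "finite A \<Longrightarrow> Poly_Mapping.keys f \<subseteq> A \<Longrightarrow> extend w g f = (\<Sum>a\<in>A. w (Poly_Mapping.lookup f a) (g a))"
  unfolding extend_def by (rule sum.mono_neutral_left) (auto simp: in_keys_iff)

lemma linear_extend: "Vector_Spaces.linear free_scale w (extend w g)"
proof (rule linearI[OF vector_space_free_scale w])
  fix x y :: "'a \<Rightarrow>\<^sub>0 'k" and c
  let ?A = "Poly_Mapping.keys x \<union> Poly_Mapping.keys y"
  have "Poly_Mapping.keys (x + y) \<subseteq> ?A" by (rule keys_add)
  thus "extend w g (x + y) = extend w g x + extend w g y"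
    by (simp add: extend_superset[of ?A] lookup_add scale_left_distrib sum.distrib)
  have "Poly_Mapping.keys (free_scale c x) \<subseteq> Poly_Mapping.keys x"
    by (auto simp: in_keys_iff)
  thus "extend w g (free_scale c x) = w c (extend w g x)"
    by (simp add: extend_superset[of "Poly_Mapping.keys x"] scale_sum_right)
qed

lemma extend_generator: "extend w g (generator a) = g a"
  by (simp add: extend_def)

lemma extend_formal_sum: "extend w g (formal_sum xs) = (\<Sum>a\<leftarrow>xs. g a)"
proof -
  note lin = linear_extend[of g]
  show ?thesis unfolding formal_sum_def
    by (induction xs) (simp_all add: linear_zero[OF lin] linear_add[OF lin] extend_generator)
qed

lemma extend_eq:
  assumes "formal_sum xs - formal_sum ys \<in> module.span free_scale X"
    and "\<And>x. x \<in> X \<Longrightarrow> extend w g x = 0"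
  shows "(\<Sum>a\<leftarrow>xs. g a) = (\<Sum>a\<leftarrow>ys. g a)"
proof -
  interpret e: Vector_Spaces.linear free_scale w "extend w g" by (rule linear_extend)
  have "extend w g (formal_sum xs - formal_sum ys) = 0"
    using assms e.eq_0_on_span by blast
  thus ?thesis by (simp add: e.diff extend_formal_sum)
qed

lemma contract_tensor_eq:
  assumes "tensor_eq s t xs ys" and B: "bilinear_map s t w B"
  shows "contract xs B = contract ys B"
  unfolding contract_def
proof (rule extend_eq)
  show "formal_sum xs - formal_sum ys \<in> module.span free_scale (tensor_relations s t)"
    using assms(1) by (simp add: tensor_eq_def)
  interpret e: Vector_Spaces.linear free_scale w "extend w (\<lambda>(a, b). B a b)" by (rule linear_extend)
  note B' = bilinear_map_left[OF B] bilinear_map_right[OF B]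
  show "extend w (\<lambda>(a, b). B a b) x = 0" if "x \<in> tensor_relations s t" for x
    using that unfolding tensor_relations_def
    by (auto simp: e.diff e.scale extend_generator B'[THEN linear_add] B'[THEN linear_scale])
qed

lemma contract3_tensor3_eq:
  assumes "tensor3_eq s t u xs ys"
    and B: "\<And>b d. Vector_Spaces.linear s w (\<lambda>a. B a b d)" "\<And>a d. Vector_Spaces.linear t w (\<lambda>b. B a b d)"
      "\<And>a b. Vector_Spaces.linear u w (\<lambda>d. B a b d)"
  shows "contract3 xs B = contract3 ys B"
  unfolding contract3_def
proof (rule extend_eq)
  show "formal_sum xs - formal_sum ys \<in> module.span free_scale (tensor3_relations s t u)"
    using assms(1) by (simp add: tensor3_eq_def)
  interpret e: Vector_Spaces.linear free_scale w "extend w (\<lambda>(a, b, d). B a b d)" by (rule linear_extend)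
  show "extend w (\<lambda>(a, b, d). B a b d) x = 0" if "x \<in> tensor3_relations s t u" for x
    using that unfolding tensor3_relations_def
    by (auto simp: e.diff e.scale extend_generator B[THEN linear_add] B[THEN linear_scale])
qed

end

lemma linear_contract_tensor_linear:
  assumes f: "tensor_linear r s t f" and r: "vector_space r" and B: "bilinear_map s t w B"
  shows "Vector_Spaces.linear r w (\<lambda>x. contract (f x) B)"
proof -
  note B' = bilinear_map_left[OF B]
  have w: "vector_space w" using B' by (rule linear_vector_space2)
  show ?thesis
  proof (rule linearI[OF r w])
    show "contract (f (x + y)) B = contract (f x) B + contract (f y) B" for x y
      using f contract_tensor_eq[OF w _ B, of "f (x + y)" "f x @ f y"] by (auto simp: tensor_linear_def)
    fix c x
    have "contract (f (r c x)) B = contract (map (\<lambda>(a, b). (s c a, b)) (f x)) B"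
      using f contract_tensor_eq[OF w _ B, of "f (r c x)" "map (\<lambda>(a, b). (s c a, b)) (f x)"] by (auto simp: tensor_linear_def)
    thus "contract (f (r c x)) B = w c (contract (f x) B)"
      by (simp add: contract_map linear_scale[OF B'] contract_scale[OF w])
  qed
qed

section \<open>Graded vector spaces\<close>

locale graded_space = vector_space s
  for s :: "'k::field \<Rightarrow> 'a::ab_group_add \<Rightarrow> 'a" (infixr \<open>*s\<close> 75) +
  fixes C :: "nat \<Rightarrow> 'a set"
  assumes subspace_component: "subspace (C n)"
    and decomposition: "\<exists>!f. (\<forall>n. f n \<in> C n) \<and> finite {n. f n \<noteq> 0} \<and> x = (\<Sum>n | f n \<noteq> 0. f n)"
begin

definition pr :: "nat \<Rightarrow> 'a \<Rightarrow> 'a" where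
  "pr n x = (THE f. (\<forall>n. f n \<in> C n) \<and> finite {n. f n \<noteq> 0} \<and> x = (\<Sum>n | f n \<noteq> 0. f n)) n"

lemma
  shows pr_in: "pr n x \<in> C n"
    and finite_pr: "finite {n. pr n x \<noteq> 0}"
    and sum_pr: "(\<Sum>n | pr n x \<noteq> 0. pr n x) = x"
proof -
  let ?f = "THE f. (\<forall>n. f n \<in> C n) \<and> finite {n. f n \<noteq> 0} \<and> x = (\<Sum>n | f n \<noteq> 0. f n)"
  have "(\<forall>n. ?f n \<in> C n) \<and> finite {n. ?f n \<noteq> 0} \<and> x = (\<Sum>n | ?f n \<noteq> 0. ?f n)"
    by (rule theI'[OF decomposition])
  thus "pr n x \<in> C n" "finite {n. pr n x \<noteq> 0}" "(\<Sum>n | pr n x \<noteq> 0. pr n x) = x"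
    unfolding pr_def by auto
qed

lemma pr_unique:
  assumes "\<And>n. f n \<in> C n" "finite A" "\<And>n. n \<notin> A \<Longrightarrow> f n = 0" "x = (\<Sum>n\<in>A. f n)"
  shows "pr n x = f n"
proof -
  have sub: "{n. f n \<noteq> 0} \<subseteq> A" using assms(3) by auto
  hence "finite {n. f n \<noteq> 0}" using assms(2) finite_subset by blast
  moreover have "x = (\<Sum>n | f n \<noteq> 0. f n)"
    unfolding assms(4) by (rule sum.mono_neutral_right) (use sub assms(2) in auto)
  ultimately have f: "(\<forall>n. f n \<in> C n) \<and> finite {n. f n \<noteq> 0} \<and> x = (\<Sum>n | f n \<noteq> 0. f n)"
    using assms(1) by blast
  have "(THE f. (\<forall>n. f n \<in> C n) \<and> finite {n. f n \<noteq> 0} \<and> x = (\<Sum>n | f n \<noteq> 0. f n)) = f"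
    by (rule the1_equality[OF decomposition[of x]]) (rule f)
  thus ?thesis unfolding pr_def by simp
qed

lemma sum_pr_superset: "finite A \<Longrightarrow> {n. pr n x \<noteq> 0} \<subseteq> A \<Longrightarrow> (\<Sum>n\<in>A. pr n x) = x"
  by (subst (2) sum_pr[symmetric], rule sum.mono_neutral_right) auto

lemma linear_pr: "Vector_Spaces.linear s s (pr n)"
proof (rule linearI[OF vector_space_axioms vector_space_axioms])
  fix x y :: 'a and c
  let ?A = "{n. pr n x \<noteq> 0} \<union> {n. pr n y \<noteq> 0}"
  show "pr n (x + y) = pr n x + pr n y"
    by (rule pr_unique[of "\<lambda>n. pr n x + pr n y" ?A])
      (auto simp: finite_pr sum.distrib sum_pr_superset subspace_add[OF subspace_component] pr_in)
  show "pr n (c *s x) = c *s pr n x"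
    by (rule pr_unique[of "\<lambda>n. c *s pr n x" "{n. pr n x \<noteq> 0}"])
      (auto simp: finite_pr sum_pr scale_sum_right[symmetric] subspace_scale[OF subspace_component] pr_in)
qed

lemmas pr_simps [simp] = linear_add[OF linear_pr] linear_scale[OF linear_pr] linear_zero[OF linear_pr]

lemma pr_component: "x \<in> C n \<Longrightarrow> pr m x = (if m = n then x else 0)"
  by (rule pr_unique[of _ "{n}"]) (auto simp: subspace_0[OF subspace_component])

lemma pr_pr [simp]: "pr m (pr n x) = (if m = n then pr n x else 0)"
  by (rule pr_component[OF pr_in])

lemma in_component_iff: "x \<in> C n \<longleftrightarrow> pr n x = x"
  using pr_component pr_in by metis

text \<open>
  This reduces identities between linear maps to homogeneous arguments.
\<close>
lemma linear_eq_on_components: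
  assumes "Vector_Spaces.linear s w f" "Vector_Spaces.linear s w g" "\<And>n x. x \<in> C n \<Longrightarrow> f x = g x"
  shows "f x = g x"
proof -
  have "f x = (\<Sum>n | pr n x \<noteq> 0. f (pr n x))" using linear_sum[OF assms(1)] sum_pr[of x] by metis
  also have "\<dots> = (\<Sum>n | pr n x \<noteq> 0. g (pr n x))" by (simp add: assms(3)[OF pr_in])
  also have "\<dots> = g x" using linear_sum[OF assms(2)] sum_pr[of x] by metis
  finally show ?thesis .
qed

end

lemma linear_pr_commute:
  assumes "graded_space s C" "graded_space t D" and f: "Vector_Spaces.linear s t f"
    and deg: "\<And>n x. x \<in> C n \<Longrightarrow> f x \<in> D n"
  shows "f (graded_space.pr C n x) = graded_space.pr D n (f x)"
proof -
  interpret C: graded_space s C by fact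
  interpret D: graded_space t D by fact
  show ?thesis
  proof (rule C.linear_eq_on_components)
    show "Vector_Spaces.linear s t (\<lambda>x. f (C.pr n x))" by (rule linear_compose[OF C.linear_pr f])
    show "Vector_Spaces.linear s t (\<lambda>x. D.pr n (f x))" by (rule linear_compose[OF f D.linear_pr])
    show "f (C.pr n x) = D.pr n (f x)" if "x \<in> C m" for m x
      using that deg[OF that] by (simp add: C.pr_component D.pr_component linear_zero[OF f])
  qed
qed

section \<open>Braided Hopf algebras\<close>

sublocale unital_algebra \<subseteq> vs: vector_space "scalar A"
  by (rule vector_space)

context unital_algebra
begin

lemmas mult_simps [simp] =
  linear_add[OF mult_linear_left] linear_scale[OF mult_linear_left] linear_zero[OF mult_linear_left]
  linear_add[OF mult_linear_right] linear_scale[OF mult_linear_right] linear_zero[OF mult_linear_right]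
  mult_one_left mult_one_right

end

context counital_coalgebra
begin

lemmas counit_simps [simp] =
  linear_add[OF counit_linear] linear_scale[OF counit_linear] linear_zero[OF counit_linear]

lemma linear_comult:
  "bilinear_map (scalar A) (scalar A) w B \<Longrightarrow> Vector_Spaces.linear (scalar A) w (\<lambda>x. contract (\<Delta> x) B)"
  using comult_linear vector_space by (rule linear_contract_tensor_linear)

lemma contract_comult_coassoc:
  assumes "\<And>b d. Vector_Spaces.linear (scalar A) w (\<lambda>a. B a b d)"
    "\<And>a d. Vector_Spaces.linear (scalar A) w (\<lambda>b. B a b d)"
    "\<And>a b. Vector_Spaces.linear (scalar A) w (\<lambda>d. B a b d)"
  shows "contract (\<Delta> x) (\<lambda>y b. contract (\<Delta> y) (\<lambda>a a'. B a a' b))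
    = contract (\<Delta> x) (\<lambda>a y. contract (\<Delta> y) (\<lambda>b b'. B a b b'))"
  using contract3_tensor3_eq[OF linear_vector_space2[OF assms(1)] comult_coassoc[of x], of B] assms
  by (simp add: contract3_concat contract3_map contract3_map_Pair)

lemma contract_counit_left:
  assumes "Vector_Spaces.linear (scalar A) w f"
  shows "contract (\<Delta> x) (\<lambda>a b. w (\<epsilon> a) (f b)) = f x"
proof -
  have "f x = f (contract (\<Delta> x) (\<lambda>a b. \<epsilon> a \<odot> b))" by (simp add: contract_def counit_left)
  thus ?thesis by (simp add: linear_contract[OF assms] linear_scale[OF assms])
qed

lemma contract_counit_right:
  assumes "Vector_Spaces.linear (scalar A) w f"
  shows "contract (\<Delta> x) (\<lambda>a b. w (\<epsilon> b) (f a)) = f x"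
proof -
  have "f x = f (contract (\<Delta> x) (\<lambda>a b. \<epsilon> b \<odot> a))" by (simp add: contract_def counit_right)
  thus ?thesis by (simp add: linear_contract[OF assms] linear_scale[OF assms])
qed

end

context algebra_coalgebra_antipode
begin

lemmas antipode_simps [simp] =
  linear_add[OF antipode_linear] linear_scale[OF antipode_linear] linear_zero[OF antipode_linear]

lemma contract_antipode_left: "contract (\<Delta> x) (\<lambda>a b. \<S> a \<cdot> b) = \<epsilon> x \<odot> \<one>"
  and contract_antipode_right: "contract (\<Delta> x) (\<lambda>a b. a \<cdot> \<S> b) = \<epsilon> x \<odot> \<one>"
  by (simp_all add: contract_def antipode_left antipode_right)

end

context braided_hopf_algebra
begin

lemmas act_simps [simp] =
  linear_add[OF act_linear_left] linear_scale[OF act_linear_left] linear_zero[OF act_linear_left]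
  linear_add[OF act_linear_right] linear_scale[OF act_linear_right] linear_zero[OF act_linear_right]

lemma linear_coact:
  "bilinear_map (scalar K) (scalar R) w B \<Longrightarrow> Vector_Spaces.linear (scalar R) w (\<lambda>x. contract (\<delta> x) B)"
  using coact_linear vs.vector_space_axioms by (rule linear_contract_tensor_linear)

lemma contract_coact_counit:
  assumes "Vector_Spaces.linear (scalar R) w f"
  shows "contract (\<delta> x) (\<lambda>g y. w (\<epsilon>\<^bsub>K\<^esub> g) (f y)) = f x"
proof -
  have "f x = f (contract (\<delta> x) (\<lambda>g y. \<epsilon>\<^bsub>K\<^esub> g \<odot> y))" by (simp add: contract_def coact_counit)
  thus ?thesis by (simp add: linear_contract[OF assms] linear_scale[OF assms])
qed

lemma contract_comult_mult:
  assumes "bilinear_map (scalar R) (scalar R) w B"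
  shows "contract (\<Delta> (x \<cdot> y)) B = contract (\<Delta> x) (\<lambda>x\<^sub>1 x\<^sub>2. contract (\<Delta> y) (\<lambda>y\<^sub>1 y\<^sub>2.
    contract (\<delta> x\<^sub>2) (\<lambda>g x\<^sub>2\<^sub>0. B (x\<^sub>1 \<cdot> (g \<triangleright> y\<^sub>1)) (x\<^sub>2\<^sub>0 \<cdot> y\<^sub>2))))"
  using contract_tensor_eq[OF linear_vector_space2[OF bilinear_map_left[OF assms]] comult_mult[of x y] assms]
  by (simp add: contract_concat contract_map)

text \<open>
  The composite \<open>S (h y)\<close> of antipode and product is not expanded. Instead let \<open>G h\<close> be the
  left-hand side. Multiplicativity of \<open>\<Delta>\<close> turns \<open>h\<^sub>1 G(h\<^sub>2)\<close> into
  \<open>(h y)\<^sub>1 S((h y)\<^sub>2) = \<epsilon> h \<epsilon> y\<close>. Evaluating \<open>S(h\<^sub>1) h\<^sub>2 G(h\<^sub>3)\<close> in two ways then gives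
  \<open>G h = \<epsilon> y S h\<close>.
\<close>
lemma contract_act_antipode:
  "contract (\<Delta> y) (\<lambda>y\<^sub>1 y\<^sub>2. contract (\<delta> h) (\<lambda>g h\<^sub>0. (g \<triangleright> y\<^sub>1) \<cdot> \<S> (h\<^sub>0 \<cdot> y\<^sub>2))) = \<epsilon> y \<odot> \<S> h"
proof -
  note V = vs.vector_space_axioms K.vs.vector_space_axioms
  define G where "G h = contract (\<Delta> y) (\<lambda>y\<^sub>1 y\<^sub>2. contract (\<delta> h) (\<lambda>g h\<^sub>0. (g \<triangleright> y\<^sub>1) \<cdot> \<S> (h\<^sub>0 \<cdot> y\<^sub>2)))" for h
  have G: "Vector_Spaces.linear (scalar R) (scalar R) G"
    unfolding G_def by (intro linear_contract_pointwise linear_coact bilinear_mapI V) simp_all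
  note [simp] = linear_add[OF G] linear_scale[OF G]
  have 1: "contract (\<Delta> h) (\<lambda>a b. a \<cdot> G b) = (\<epsilon> h * \<epsilon> y) \<odot> \<one>" for h
  proof -
    have "(\<epsilon> h * \<epsilon> y) \<odot> \<one> = contract (\<Delta> (h \<cdot> y)) (\<lambda>a b. a \<cdot> \<S> b)"
      by (simp add: contract_antipode_right counit_mult)
    also have "\<dots> = contract (\<Delta> h) (\<lambda>x\<^sub>1 x\<^sub>2. contract (\<Delta> y) (\<lambda>y\<^sub>1 y\<^sub>2.
        contract (\<delta> x\<^sub>2) (\<lambda>g x\<^sub>2\<^sub>0. (x\<^sub>1 \<cdot> (g \<triangleright> y\<^sub>1)) \<cdot> \<S> (x\<^sub>2\<^sub>0 \<cdot> y\<^sub>2))))"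
      by (intro contract_comult_mult[where w = "scalar R"] bilinear_mapI V) simp_all
    also have "\<dots> = contract (\<Delta> h) (\<lambda>a b. a \<cdot> G b)"
      unfolding G_def by (simp add: linear_contract[OF mult_linear_right] mult_assoc)
    finally show ?thesis by simp
  qed
  have "G h = contract (\<Delta> h) (\<lambda>a b. \<epsilon> a \<odot> G b)"
    by (rule contract_counit_left[OF G, symmetric])
  also have "\<dots> = contract (\<Delta> h) (\<lambda>c b. contract (\<Delta> c) (\<lambda>a a'. (\<S> a \<cdot> a') \<cdot> G b))"
    by (simp add: linear_contract[OF mult_linear_left, symmetric] contract_antipode_left)
  also have "\<dots> = contract (\<Delta> h) (\<lambda>a c. contract (\<Delta> c) (\<lambda>b b'. (\<S> a \<cdot> b) \<cdot> G b'))"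
    by (intro contract_comult_coassoc[where w = "scalar R"] linearI V) simp_all
  also have "\<dots> = contract (\<Delta> h) (\<lambda>a c. \<epsilon> c \<odot> (\<epsilon> y \<odot> \<S> a))"
    by (simp add: mult_assoc linear_contract[OF mult_linear_right, symmetric] 1)
  also have "\<dots> = \<epsilon> y \<odot> \<S> h"
    by (rule contract_counit_right)
      (intro linearI V; simp add: vs.scale_right_distrib vs.scale_left_commute mult.commute)
  finally show ?thesis by (simp add: G_def)
qed

end

section \<open>Graded braided Hopf algebras\<close>

sublocale graded_braided_hopf_algebra \<subseteq> gr: graded_space "scalar R" "component R"
  by unfold_locales (use component_subspace direct_sum in auto)

context graded_braided_hopf_algebra
begin

lemma pr_mult: "gr.pr n (x \<cdot> y) = (\<Sum>i\<le>n. gr.pr i x \<cdot> gr.pr (n - i) y)"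
proof -
  note V = vs.vector_space_axioms
  note L = vs.scale_right_distrib sum.distrib vs.scale_sum_right
  show ?thesis
  proof (rule gr.linear_eq_on_components[where w = "scalar R" and x = x])
    fix m x assume x: "x \<in> component R m"
    show "gr.pr n (x \<cdot> y) = (\<Sum>i\<le>n. gr.pr i x \<cdot> gr.pr (n - i) y)"
    proof (rule gr.linear_eq_on_components[where w = "scalar R" and x = y])
      fix k y assume y: "y \<in> component R k"
      have "(\<Sum>i\<le>n. gr.pr i x \<cdot> gr.pr (n - i) y)
          = (\<Sum>i\<le>n. if i = m then x \<cdot> gr.pr (n - m) y else 0)"
        by (rule sum.cong) (auto simp: gr.pr_component[OF x])
      thus "gr.pr n (x \<cdot> y) = (\<Sum>i\<le>n. gr.pr i x \<cdot> gr.pr (n - i) y)"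
        by (auto simp: gr.pr_component[OF y] gr.pr_component[OF component_mult[OF x y]])
    qed (intro linearI V; simp add: L)+
  qed (intro linearI V; simp add: L)+
qed

lemma pr_0_mult: "gr.pr 0 (x \<cdot> y) = gr.pr 0 x \<cdot> gr.pr 0 y"
  by (simp add: pr_mult)

text \<open>
  The comultiplication respects the grading: the part of degree \<open>n\<close> of \<open>\<Delta> x\<close> is \<open>\<Delta> (pr n x)\<close>.
\<close>
lemma contract_comult_pr:
  assumes B: "bilinear_map (scalar R) (scalar R) w B"
  shows "contract (\<Delta> (gr.pr n x)) B
    = (\<Sum>i\<le>n. contract (\<Delta> x) (\<lambda>a b. B (gr.pr i a) (gr.pr (n - i) b)))"
proof -
  note [simp] = linear_add[OF bilinear_map_left[OF B]] linear_scale[OF bilinear_map_left[OF B]]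
    linear_zero[OF bilinear_map_left[OF B]]
    linear_add[OF bilinear_map_right[OF B]] linear_scale[OF bilinear_map_right[OF B]]
    linear_zero[OF bilinear_map_right[OF B]]
  have w: "vector_space w" by (rule linear_vector_space2[OF bilinear_map_left[OF B]])
  note V = vs.vector_space_axioms w
  interpret w: vector_space w by (rule w)
  have B': "bilinear_map (scalar R) (scalar R) w (\<lambda>a b. \<Sum>i\<le>n. B (gr.pr i a) (gr.pr (n - i) b))"
    by (intro bilinear_mapI V) (simp_all add: sum.distrib w.scale_sum_right)
  show ?thesis
    unfolding contract_sum[symmetric]
  proof (rule gr.linear_eq_on_components[where x = x])
    show "Vector_Spaces.linear (scalar R) w (\<lambda>x. contract (\<Delta> (gr.pr n x)) B)"
      by (rule linear_compose[OF gr.linear_pr linear_comult[OF B]])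
    show "Vector_Spaces.linear (scalar R) w
        (\<lambda>x. contract (\<Delta> x) (\<lambda>a b. \<Sum>i\<le>n. B (gr.pr i a) (gr.pr (n - i) b)))"
      by (rule linear_comult[OF B'])
    fix m x assume x: "x \<in> component R m"
    obtain zs where zs: "tensor_eq (scalar R) (scalar R) (\<Delta> x) zs"
      "\<forall>(a, b)\<in>set zs. \<exists>i j. i + j = m \<and> a \<in> component R i \<and> b \<in> component R j"
      using component_comult[OF x] by blast
    have "contract zs (\<lambda>a b. \<Sum>i\<le>n. B (gr.pr i a) (gr.pr (n - i) b))
        = contract zs (\<lambda>a b. if m = n then B a b else 0)"
    proof (rule contract_cong)
      fix a b assume "(a, b) \<in> set zs"
      then obtain k j where kj: "k + j = m" and a: "a \<in> component R k" and b: "b \<in> component R j"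
        using zs(2) by fast
      have "(\<Sum>i\<le>n. B (gr.pr i a) (gr.pr (n - i) b)) = (\<Sum>i\<le>n. if i = k then B a (gr.pr (n - k) b) else 0)"
        by (rule sum.cong) (auto simp: gr.pr_component[OF a])
      thus "(\<Sum>i\<le>n. B (gr.pr i a) (gr.pr (n - i) b)) = (if m = n then B a b else 0)"
        using kj by (auto simp: gr.pr_component[OF b])
    qed
    thus "contract (\<Delta> (gr.pr n x)) B
        = contract (\<Delta> x) (\<lambda>a b. \<Sum>i\<le>n. B (gr.pr i a) (gr.pr (n - i) b))"
      using contract_tensor_eq[OF w zs(1) B] contract_tensor_eq[OF w zs(1) B'] linear_zero[OF linear_comult[OF B]]
      by (auto simp: gr.pr_component[OF x])
  qed
qed

lemma contract_comult_pr_0: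
  "bilinear_map (scalar R) (scalar R) w B \<Longrightarrow>
    contract (\<Delta> (gr.pr 0 x)) B = contract (\<Delta> x) (\<lambda>a b. B (gr.pr 0 a) (gr.pr 0 b))"
  by (simp add: contract_comult_pr)

lemma contract_coact_pr:
  assumes B: "bilinear_map (scalar K) (scalar R) w B"
  shows "contract (\<delta> (gr.pr n x)) B = contract (\<delta> x) (\<lambda>g y. B g (gr.pr n y))"
proof -
  note [simp] = linear_add[OF bilinear_map_left[OF B]] linear_scale[OF bilinear_map_left[OF B]]
    linear_add[OF bilinear_map_right[OF B]] linear_scale[OF bilinear_map_right[OF B]]
    linear_zero[OF bilinear_map_right[OF B]]
  have w: "vector_space w" by (rule linear_vector_space2[OF bilinear_map_left[OF B]])
  note V = vs.vector_space_axioms K.vs.vector_space_axioms w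
  have B': "bilinear_map (scalar K) (scalar R) w (\<lambda>g y. B g (gr.pr n y))"
    by (intro bilinear_mapI V) simp_all
  show ?thesis
  proof (rule gr.linear_eq_on_components[where x = x])
    show "Vector_Spaces.linear (scalar R) w (\<lambda>x. contract (\<delta> (gr.pr n x)) B)"
      by (rule linear_compose[OF gr.linear_pr linear_coact[OF B]])
    show "Vector_Spaces.linear (scalar R) w (\<lambda>x. contract (\<delta> x) (\<lambda>g y. B g (gr.pr n y)))"
      by (rule linear_coact[OF B'])
    fix m x assume x: "x \<in> component R m"
    obtain zs where zs: "tensor_eq (scalar K) (scalar R) (\<delta> x) zs" "\<forall>(g, y)\<in>set zs. y \<in> component R m"
      using component_coact[OF x] by blast
    have "contract zs (\<lambda>g y. B g (gr.pr n y)) = contract zs (\<lambda>g y. if n = m then B g y else 0)"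
      by (rule contract_cong) (use zs(2) in \<open>auto simp: gr.pr_component\<close>)
    thus "contract (\<delta> (gr.pr n x)) B = contract (\<delta> x) (\<lambda>g y. B g (gr.pr n y))"
      using contract_tensor_eq[OF w zs(1) B] contract_tensor_eq[OF w zs(1) B'] linear_zero[OF linear_coact[OF B]]
      by (auto simp: gr.pr_component[OF x])
  qed
qed

lemma counit_pr_0 [simp]: "\<epsilon> (gr.pr 0 x) = \<epsilon> x"
proof (rule gr.linear_eq_on_components[where x = x])
  show "Vector_Spaces.linear (scalar R) (*) (\<lambda>x. \<epsilon> (gr.pr 0 x))"
    by (rule linear_compose[OF gr.linear_pr counit_linear])
  show "\<epsilon> (gr.pr 0 x) = \<epsilon> x" if "x \<in> component R n" for n x
    using component_counit[OF that] by (auto simp: gr.pr_component[OF that])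
qed (rule counit_linear)

lemma pr_antipode: "gr.pr n (\<S> x) = \<S> (gr.pr n x)"
  by (rule linear_pr_commute[OF gr.graded_space_axioms gr.graded_space_axioms antipode_linear, symmetric])
    (rule component_antipode)

text \<open>
  The map \<open>x \<mapsto> x\<^sub>1 S(p x\<^sub>2)\<close>, where \<open>p\<close> is the projection onto degree \<open>0\<close>. With respect to the
  coaction \<open>x \<mapsto> x\<^sub>1 \<otimes> p x\<^sub>2\<close>, it is the projection onto coinvariants from the fundamental
  theorem of Hopf modules over the degree \<open>0\<close> part.
\<close>
definition coinv :: "'a \<Rightarrow> 'a" where
  "coinv x = contract (\<Delta> x) (\<lambda>a b. a \<cdot> \<S> (gr.pr 0 b))"

lemma linear_coinv: "Vector_Spaces.linear (scalar R) (scalar R) coinv"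
  unfolding coinv_def[abs_def] by (intro linear_comult bilinear_mapI vs.vector_space_axioms) simp_all

lemmas coinv_simps [simp] = linear_add[OF linear_coinv] linear_scale[OF linear_coinv] linear_zero[OF linear_coinv]

lemma coinv_pr: "coinv (gr.pr n x) = gr.pr n (coinv x)"
proof -
  have "coinv (gr.pr n x) = (\<Sum>i\<le>n. contract (\<Delta> x) (\<lambda>a b. gr.pr i a \<cdot> \<S> (gr.pr 0 (gr.pr (n - i) b))))"
    unfolding coinv_def by (intro contract_comult_pr[where w = "scalar R"] bilinear_mapI vs.vector_space_axioms) simp_all
  also have "\<dots> = contract (\<Delta> x) (\<lambda>a b. \<Sum>i\<le>n. gr.pr i a \<cdot> gr.pr (n - i) (\<S> (gr.pr 0 b)))"
    unfolding contract_sum[symmetric]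
    by (intro contract_cong sum.cong) (auto simp: pr_antipode)
  also have "\<dots> = gr.pr n (coinv x)"
    by (simp add: coinv_def linear_contract[OF gr.linear_pr] pr_mult)
  finally show ?thesis .
qed

text \<open>
  Expanding \<open>\<Delta> (x y)\<close> gives \<open>x\<^sub>1\<close> times an instance of the left-hand side of
  \<open>contract_act_antipode\<close> at \<open>h = p x\<^sub>2\<close>, since the projection \<open>p\<close> is multiplicative and
  colinear over \<open>K\<close>.
\<close>
lemma coinv_mult_degree_0:
  assumes y: "y \<in> component R 0"
  shows "coinv (x \<cdot> y) = \<epsilon> y \<odot> coinv x"
proof -
  note V = vs.vector_space_axioms K.vs.vector_space_axioms
  have y0: "gr.pr 0 y = y" using gr.pr_component[OF y] by simp
  have G: "contract (\<Delta> y) (\<lambda>y\<^sub>1 y\<^sub>2. contract (\<delta> h) (\<lambda>g h\<^sub>0. (g \<triangleright> y\<^sub>1) \<cdot> \<S> (gr.pr 0 (h\<^sub>0 \<cdot> y\<^sub>2))))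
      = \<epsilon> y \<odot> \<S> (gr.pr 0 h)" (is "contract (\<Delta> y) ?B = _") for h
  proof -
    have "contract (\<Delta> y) ?B = contract (\<Delta> y) (\<lambda>y\<^sub>1 y\<^sub>2. ?B (gr.pr 0 y\<^sub>1) (gr.pr 0 y\<^sub>2))"
      by (subst (1) y0[symmetric], intro contract_comult_pr_0[where w = "scalar R"] bilinear_mapI V)
        (simp_all add: contract_add contract_scale[OF V(1)])
    also have "\<dots> = contract (\<Delta> y) (\<lambda>y\<^sub>1 y\<^sub>2. contract (\<delta> (gr.pr 0 h))
        (\<lambda>g h\<^sub>0. (g \<triangleright> gr.pr 0 y\<^sub>1) \<cdot> \<S> (h\<^sub>0 \<cdot> gr.pr 0 y\<^sub>2)))"
      by (subst contract_coact_pr[where w = "scalar R"], intro bilinear_mapI V) (simp_all add: pr_0_mult)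
    also have "\<dots> = contract (\<Delta> (gr.pr 0 y)) (\<lambda>y\<^sub>1 y\<^sub>2. contract (\<delta> (gr.pr 0 h))
        (\<lambda>g h\<^sub>0. (g \<triangleright> y\<^sub>1) \<cdot> \<S> (h\<^sub>0 \<cdot> y\<^sub>2)))"
      by (intro contract_comult_pr_0[where w = "scalar R", symmetric] bilinear_mapI V)
        (simp_all add: contract_add contract_scale[OF V(1)])
    finally show ?thesis by (simp add: contract_act_antipode)
  qed
  have "coinv (x \<cdot> y) = contract (\<Delta> x) (\<lambda>x\<^sub>1 x\<^sub>2. contract (\<Delta> y) (\<lambda>y\<^sub>1 y\<^sub>2.
      contract (\<delta> x\<^sub>2) (\<lambda>g x\<^sub>2\<^sub>0. (x\<^sub>1 \<cdot> (g \<triangleright> y\<^sub>1)) \<cdot> \<S> (gr.pr 0 (x\<^sub>2\<^sub>0 \<cdot> y\<^sub>2)))))"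
    unfolding coinv_def by (intro contract_comult_mult[where w = "scalar R"] bilinear_mapI V) simp_all
  also have "\<dots> = contract (\<Delta> x) (\<lambda>x\<^sub>1 x\<^sub>2. x\<^sub>1 \<cdot> (\<epsilon> y \<odot> \<S> (gr.pr 0 x\<^sub>2)))"
    by (simp only: mult_assoc linear_contract[OF mult_linear_right, symmetric] G)
  also have "\<dots> = \<epsilon> y \<odot> coinv x"
    by (simp add: coinv_def contract_scale[OF V(1)])
  finally show ?thesis .
qed

lemma coinv_pr_0: "coinv (gr.pr 0 x) = \<epsilon> x \<odot> \<one>"
proof -
  have "coinv (gr.pr 0 x) = contract (\<Delta> x) (\<lambda>a b. gr.pr 0 a \<cdot> \<S> (gr.pr 0 (gr.pr 0 b)))"
    unfolding coinv_def
    by (intro contract_comult_pr_0[where w = "scalar R"] bilinear_mapI vs.vector_space_axioms) simp_all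
  also have "\<dots> = contract (\<Delta> (gr.pr 0 x)) (\<lambda>a b. a \<cdot> \<S> b)"
    by (subst contract_comult_pr_0[where w = "scalar R"], intro bilinear_mapI vs.vector_space_axioms) simp_all
  finally show ?thesis by (simp add: contract_antipode_right)
qed

text \<open>
  The reconstruction formula of the fundamental theorem of Hopf modules:
  \<open>x\<^sub>1 S(p x\<^sub>2) p(x\<^sub>3) = x\<close>.
\<close>
lemma contract_coinv_pr_0: "contract (\<Delta> y) (\<lambda>a b. coinv a \<cdot> gr.pr 0 b) = y"
proof -
  note V = vs.vector_space_axioms
  have S: "contract (\<Delta> b) (\<lambda>b\<^sub>1 b\<^sub>2. \<S> (gr.pr 0 b\<^sub>1) \<cdot> gr.pr 0 b\<^sub>2) = \<epsilon> b \<odot> \<one>" for b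
  proof -
    have "contract (\<Delta> b) (\<lambda>b\<^sub>1 b\<^sub>2. \<S> (gr.pr 0 b\<^sub>1) \<cdot> gr.pr 0 b\<^sub>2) = contract (\<Delta> (gr.pr 0 b)) (\<lambda>a b. \<S> a \<cdot> b)"
      by (intro contract_comult_pr_0[where w = "scalar R", symmetric] bilinear_mapI V) simp_all
    thus ?thesis by (simp add: contract_antipode_left)
  qed
  have "contract (\<Delta> y) (\<lambda>a b. coinv a \<cdot> gr.pr 0 b)
      = contract (\<Delta> y) (\<lambda>c b. contract (\<Delta> c) (\<lambda>a a'. (a \<cdot> \<S> (gr.pr 0 a')) \<cdot> gr.pr 0 b))"
    by (simp add: coinv_def linear_contract[OF mult_linear_left])
  also have "\<dots> = contract (\<Delta> y) (\<lambda>a c. contract (\<Delta> c) (\<lambda>b b'. (a \<cdot> \<S> (gr.pr 0 b)) \<cdot> gr.pr 0 b'))"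
    by (intro contract_comult_coassoc[where w = "scalar R"] linearI V) simp_all
  also have "\<dots> = contract (\<Delta> y) (\<lambda>a c. \<epsilon> c \<odot> a)"
    by (simp add: mult_assoc linear_contract[OF mult_linear_right, symmetric] S)
  also have "\<dots> = y" by (simp add: contract_def counit_right)
  finally show ?thesis .
qed

end

section \<open>The filtration defined by a map of graded braided Hopf algebras\<close>

context graded_braided_hopf_map
begin

abbreviation functional :: "('b \<Rightarrow> 'k) \<Rightarrow> bool" where
  "functional \<equiv> Vector_Spaces.linear (scalar T) (*)"

lemmas map_simps [simp] = linear_add[OF map_linear] linear_scale[OF map_linear] linear_zero[OF map_linear] map_mult

lemmas vector_spaces = R.vs.vector_space_axioms T.vs.vector_space_axioms R.K.vs.vector_space_axioms vector_space_field

lemma map_pr: "\<pi> (R.gr.pr n x) = T.gr.pr n (\<pi> x)"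
  by (rule linear_pr_commute[OF R.gr.graded_space_axioms T.gr.graded_space_axioms map_linear map_component])

lemma contract_comult_map:
  assumes "bilinear_map (scalar T) (scalar T) w B"
  shows "contract (\<Delta>\<^bsub>T\<^esub> (\<pi> x)) B = contract (\<Delta>\<^bsub>R\<^esub> x) (\<lambda>a b. B (\<pi> a) (\<pi> b))"
  using contract_tensor_eq[OF linear_vector_space2[OF bilinear_map_left[OF assms]] map_comult[of x] assms]
  by (simp add: contract_map)

lemma contract_coact_map:
  assumes "bilinear_map (scalar K) (scalar T) w B"
  shows "contract (\<delta>\<^bsub>T\<^esub> (\<pi> x)) B = contract (\<delta>\<^bsub>R\<^esub> x) (\<lambda>g y. B g (\<pi> y))"
  using contract_tensor_eq[OF linear_vector_space2[OF bilinear_map_left[OF assms]] map_coact[of x] assms]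
  by (simp add: contract_map)

text \<open>
  The comodule structure of \<open>R\<close> over \<open>T\<close>, contracted with a functional: \<open>\<phi>(\<pi> x\<^sub>2) x\<^sub>1\<close>. By
  coassociativity this is an action of the convolution algebra of functionals on \<open>T\<close> (lemma
  \<open>hit_hit\<close>).
\<close>
definition hit :: "('b \<Rightarrow> 'k) \<Rightarrow> 'a \<Rightarrow> 'a" where
  "hit \<phi> x = contract (\<Delta>\<^bsub>R\<^esub> x) (\<lambda>a b. \<phi> (\<pi> b) \<odot>\<^bsub>R\<^esub> a)"

lemma bilinear_hit:
  assumes "functional \<phi>"
  shows "bilinear_map (scalar R) (scalar R) (scalar R) (\<lambda>a b. \<phi> (\<pi> b) \<odot>\<^bsub>R\<^esub> a)"
  by (intro bilinear_mapI vector_spaces)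
    (simp_all add: R.vs.scale_right_distrib R.vs.scale_left_distrib linear_add[OF assms] linear_scale[OF assms]
      mult.commute)

lemma linear_hit: "functional \<phi> \<Longrightarrow> Vector_Spaces.linear (scalar R) (scalar R) (hit \<phi>)"
  unfolding hit_def[abs_def] by (intro R.linear_comult bilinear_hit)

lemma hit_add: "hit (\<lambda>t. \<phi> t + \<psi> t) x = hit \<phi> x + hit \<psi> x"
  by (simp add: hit_def R.vs.scale_left_distrib contract_add)

lemma hit_scale: "hit (\<lambda>t. c * \<phi> t) x = c \<odot>\<^bsub>R\<^esub> hit \<phi> x"
  by (simp add: hit_def contract_scale[OF R.vs.vector_space_axioms, symmetric])

lemma hit_counit: "hit \<epsilon>\<^bsub>T\<^esub> x = x"
  by (simp add: hit_def map_counit contract_def R.counit_right)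

definition conv :: "('b \<Rightarrow> 'k) \<Rightarrow> ('b \<Rightarrow> 'k) \<Rightarrow> 'b \<Rightarrow> 'k" where
  "conv \<phi> \<psi> t = contract (\<Delta>\<^bsub>T\<^esub> t) (\<lambda>a b. \<phi> a * \<psi> b)"

lemma bilinear_conv:
  assumes "functional \<phi>" "functional \<psi>"
  shows "bilinear_map (scalar T) (scalar T) (*) (\<lambda>a b. \<phi> a * \<psi> b)"
  by (intro bilinear_mapI vector_spaces)
    (simp_all add: assms[THEN linear_add] assms[THEN linear_scale] algebra_simps)

lemma functional_conv: "functional \<phi> \<Longrightarrow> functional \<psi> \<Longrightarrow> functional (conv \<phi> \<psi>)"
  unfolding conv_def[abs_def] by (intro T.linear_comult bilinear_conv)

lemma hit_hit:
  assumes "functional \<phi>" "functional \<psi>"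
  shows "hit \<phi> (hit \<psi> x) = hit (conv \<phi> \<psi>) x"
proof -
  have scale: "Vector_Spaces.linear (*) (scalar R) (\<lambda>c. c \<odot>\<^bsub>R\<^esub> a)" for a
    by (intro linearI vector_spaces) (simp_all add: R.vs.scale_left_distrib)
  have "hit \<phi> (hit \<psi> x) = contract (\<Delta>\<^bsub>R\<^esub> x) (\<lambda>c b. \<psi> (\<pi> b) \<odot>\<^bsub>R\<^esub> hit \<phi> c)"
    unfolding hit_def[of \<psi>]
    by (simp add: linear_contract[OF linear_hit[OF assms(1)]] linear_scale[OF linear_hit[OF assms(1)]])
  also have "\<dots> = contract (\<Delta>\<^bsub>R\<^esub> x) (\<lambda>c b. contract (\<Delta>\<^bsub>R\<^esub> c) (\<lambda>a a'. (\<phi> (\<pi> a') * \<psi> (\<pi> b)) \<odot>\<^bsub>R\<^esub> a))"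
    by (simp add: hit_def contract_scale[OF R.vs.vector_space_axioms, symmetric] mult.commute)
  also have "\<dots> = contract (\<Delta>\<^bsub>R\<^esub> x) (\<lambda>a c. contract (\<Delta>\<^bsub>R\<^esub> c) (\<lambda>b b'. (\<phi> (\<pi> b) * \<psi> (\<pi> b')) \<odot>\<^bsub>R\<^esub> a))"
    by (intro R.contract_comult_coassoc[where w = "scalar R"] linearI vector_spaces)
      (simp_all add: assms[THEN linear_add] assms[THEN linear_scale] R.vs.scale_left_distrib
        R.vs.scale_right_distrib algebra_simps)
  also have "\<dots> = hit (conv \<phi> \<psi>) x"
    by (simp add: hit_def conv_def linear_contract[OF scale] contract_comult_map[OF bilinear_conv[OF assms]])
  finally show ?thesis .
qed

text \<open>
  The tensor \<open>x\<^sub>1 \<otimes> \<pi> x\<^sub>2\<close> equals a finite sum of tensors \<open>hit (\<chi> t) x \<otimes> t\<close>. Hence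
  properties that all \<open>hit \<phi> x\<close> share hold for the left factors of a suitable representative.
\<close>
lemma hit_expansion:
  obtains I \<chi> where "finite I" "\<And>t. functional (\<chi> t)"
    "\<And>B. bilinear_map (scalar R) (scalar T) (scalar R) B \<Longrightarrow>
      contract (\<Delta>\<^bsub>R\<^esub> x) (\<lambda>a b. B a (\<pi> b)) = (\<Sum>t\<in>I. B (hit (\<chi> t) x) t)"
proof -
  obtain I \<chi> where I: "finite I" and \<chi>: "\<And>t. functional (\<chi> t)"
    and dual: "\<And>t. t \<in> (\<pi> \<circ> snd) ` set (\<Delta>\<^bsub>R\<^esub> x) \<Longrightarrow> t = (\<Sum>b\<in>I. \<chi> b t \<odot>\<^bsub>T\<^esub> b)"
    by (rule finite_dual_system[OF T.vs.vector_space_axioms, of "(\<pi> \<circ> snd) ` set (\<Delta>\<^bsub>R\<^esub> x)"]) auto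
  show thesis
  proof (rule that[OF I \<chi>])
    fix B assume B: "bilinear_map (scalar R) (scalar T) (scalar R) B"
    have "contract (\<Delta>\<^bsub>R\<^esub> x) (\<lambda>a b. B a (\<pi> b))
        = contract (\<Delta>\<^bsub>R\<^esub> x) (\<lambda>a b. \<Sum>t\<in>I. B (\<chi> t (\<pi> b) \<odot>\<^bsub>R\<^esub> a) t)"
    proof (rule contract_cong)
      fix a b assume "(a, b) \<in> set (\<Delta>\<^bsub>R\<^esub> x)"
      hence "\<pi> b = (\<Sum>t\<in>I. \<chi> t (\<pi> b) \<odot>\<^bsub>T\<^esub> t)" by (intro dual) force
      hence "B a (\<pi> b) = B a (\<Sum>t\<in>I. \<chi> t (\<pi> b) \<odot>\<^bsub>T\<^esub> t)" by simp
      thus "B a (\<pi> b) = (\<Sum>t\<in>I. B (\<chi> t (\<pi> b) \<odot>\<^bsub>R\<^esub> a) t)"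
        by (simp add: linear_sum[OF bilinear_map_right[OF B]] linear_scale[OF bilinear_map_right[OF B]]
            linear_scale[OF bilinear_map_left[OF B]])
    qed
    thus "contract (\<Delta>\<^bsub>R\<^esub> x) (\<lambda>a b. B a (\<pi> b)) = (\<Sum>t\<in>I. B (hit (\<chi> t) x) t)"
      by (simp add: contract_sum hit_def linear_contract[OF bilinear_map_left[OF B]])
  qed
qed

text \<open>
  In bidegrees: the part of \<open>x\<^sub>1 \<otimes> \<pi> x\<^sub>2\<close> with total degree \<open>n\<close> and left degree \<open>i\<close> has right
  degree \<open>n - i\<close>.
\<close>
lemma pr_hit_pr:
  assumes "functional \<phi>"
  shows "R.gr.pr i (hit \<phi> (R.gr.pr n x)) =
    (if i \<le> n then R.gr.pr i (hit (\<lambda>t. \<phi> (T.gr.pr (n - i) t)) x) else 0)"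
proof -
  have "hit \<phi> (R.gr.pr n x) = (\<Sum>j\<le>n. contract (\<Delta>\<^bsub>R\<^esub> x) (\<lambda>a b. \<phi> (\<pi> (R.gr.pr (n - j) b)) \<odot>\<^bsub>R\<^esub> R.gr.pr j a))"
    unfolding hit_def by (rule R.contract_comult_pr[OF bilinear_hit[OF assms]])
  hence "R.gr.pr i (hit \<phi> (R.gr.pr n x)) = (\<Sum>j\<le>n. contract (\<Delta>\<^bsub>R\<^esub> x)
      (\<lambda>a b. \<phi> (\<pi> (R.gr.pr (n - j) b)) \<odot>\<^bsub>R\<^esub> (if i = j then R.gr.pr j a else 0)))"
    by (simp add: linear_sum[OF R.gr.linear_pr] linear_contract[OF R.gr.linear_pr])
  also have "\<dots> = (\<Sum>j\<le>n. if j = i then contract (\<Delta>\<^bsub>R\<^esub> x)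
      (\<lambda>a b. \<phi> (\<pi> (R.gr.pr (n - i) b)) \<odot>\<^bsub>R\<^esub> R.gr.pr i a) else 0)"
    by (rule sum.cong) auto
  also have "\<dots> = (if i \<le> n then R.gr.pr i (hit (\<lambda>t. \<phi> (T.gr.pr (n - i) t)) x) else 0)"
    by (simp add: hit_def linear_contract[OF R.gr.linear_pr] map_pr)
  finally show ?thesis .
qed

definition tail :: "nat \<Rightarrow> 'a set" where
  "tail d = {x. \<forall>i<d. R.gr.pr i x = 0}"

text \<open>
  The largest subcomodule contained in \<open>tail d\<close>, the elements without components below degree
  \<open>d\<close>: the condition says that \<open>x\<^sub>1 \<otimes> \<pi> x\<^sub>2\<close> lies in \<open>tail d \<otimes> T\<close>.
\<close>
definition filtration :: "nat \<Rightarrow> 'a set" where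
  "filtration d = {x. \<forall>\<phi>. functional \<phi> \<longrightarrow> hit \<phi> x \<in> tail d}"

lemma filtration_0: "filtration 0 = UNIV"
  by (simp add: filtration_def tail_def)

lemma filtration_tail: "x \<in> filtration d \<Longrightarrow> x \<in> tail d"
  using T.counit_linear hit_counit[of x] unfolding filtration_def by force

lemma filtration_Suc: "filtration (Suc d) = {x \<in> filtration d. \<forall>\<phi>. functional \<phi> \<longrightarrow> R.gr.pr d (hit \<phi> x) = 0}"
  by (auto simp: filtration_def tail_def less_Suc_eq)

lemma subspace_filtration: "R.vs.subspace (filtration d)"
  by (rule R.vs.subspaceI)
    (auto simp: filtration_def tail_def linear_zero[OF linear_hit] linear_add[OF linear_hit] linear_scale[OF linear_hit])

lemma hit_filtration: "functional \<phi> \<Longrightarrow> x \<in> filtration d \<Longrightarrow> hit \<phi> x \<in> filtration d"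
  by (auto simp: filtration_def hit_hit functional_conv)

lemma pr_filtration:
  assumes "x \<in> filtration d"
  shows "R.gr.pr n x \<in> filtration d"
proof -
  have "R.gr.pr i (hit \<phi> (R.gr.pr n x)) = 0" if \<phi>: "functional \<phi>" and i: "i < d" for \<phi> i
  proof -
    have "functional (\<lambda>t. \<phi> (T.gr.pr (n - i) t))" by (rule linear_compose[OF T.gr.linear_pr \<phi>])
    thus ?thesis using assms i by (simp add: pr_hit_pr[OF \<phi>] filtration_def tail_def)
  qed
  thus ?thesis by (simp add: filtration_def tail_def)
qed

text \<open>
  The part \<open>\<phi>(\<pi>(x\<^sub>2\<^sub>(\<^sub>0\<^sub>) b)) x\<^sub>2\<^sub>(\<^sub>-\<^sub>1\<^sub>) \<triangleright> a\<close> of the comultiplication of a product that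
  involves the second factor \<open>x\<^sub>2\<close>. It depends only on \<open>t = \<pi> x\<^sub>2\<close>, because \<open>\<pi>\<close> is colinear
  over \<open>K\<close>.
\<close>
definition twist :: "('b \<Rightarrow> 'k) \<Rightarrow> 'a \<Rightarrow> 'a \<Rightarrow> 'b \<Rightarrow> 'a" where
  "twist \<phi> a b t = contract (\<delta>\<^bsub>T\<^esub> t) (\<lambda>g s. \<phi> (s \<cdot>\<^bsub>T\<^esub> \<pi> b) \<odot>\<^bsub>R\<^esub> (g \<triangleright>\<^bsub>R\<^esub> a))"

lemma bilinear_twist:
  assumes "functional \<phi>"
  shows "bilinear_map (scalar K) (scalar T) (scalar R) (\<lambda>g s. \<phi> (s \<cdot>\<^bsub>T\<^esub> \<pi> b) \<odot>\<^bsub>R\<^esub> (g \<triangleright>\<^bsub>R\<^esub> a))"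
  by (intro bilinear_mapI vector_spaces)
    (simp_all add: linear_add[OF assms] linear_scale[OF assms] R.vs.scale_left_distrib R.vs.scale_right_distrib
      mult.commute)

text \<open>
  The sum over \<open>I\<close> keeps the left factors of the products inside every subspace that contains \<open>x\<close>
  and is stable under all \<open>hit \<phi>\<close>; this gives both the stability of the filtration under right
  multiplication and the linearity in \<open>coinv_hit_mult\<close>.
\<close>
lemma hit_mult:
  assumes \<phi>: "functional \<phi>"
    and I: "\<And>B. bilinear_map (scalar R) (scalar T) (scalar R) B \<Longrightarrow>
      contract (\<Delta>\<^bsub>R\<^esub> x) (\<lambda>a b. B a (\<pi> b)) = (\<Sum>t\<in>I. B (hit (\<chi> t) x) t)"
  shows "hit \<phi> (x \<cdot>\<^bsub>R\<^esub> z) = contract (\<Delta>\<^bsub>R\<^esub> z) (\<lambda>a b. \<Sum>t\<in>I. hit (\<chi> t) x \<cdot>\<^bsub>R\<^esub> twist \<phi> a b t)"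
proof -
  have twist: "twist \<phi> a b (\<pi> y)
      = contract (\<delta>\<^bsub>R\<^esub> y) (\<lambda>g s. \<phi> (\<pi> s \<cdot>\<^bsub>T\<^esub> \<pi> b) \<odot>\<^bsub>R\<^esub> (g \<triangleright>\<^bsub>R\<^esub> a))" for a b y
    unfolding twist_def by (rule contract_coact_map[OF bilinear_twist[OF \<phi>]])
  have lin: "Vector_Spaces.linear (scalar T) (scalar R) (twist \<phi> a b)" for a b
    unfolding twist_def[abs_def] by (intro T.linear_coact bilinear_twist \<phi>)
  have "hit \<phi> (x \<cdot>\<^bsub>R\<^esub> z) = contract (\<Delta>\<^bsub>R\<^esub> x) (\<lambda>x\<^sub>1 x\<^sub>2. contract (\<Delta>\<^bsub>R\<^esub> z) (\<lambda>a b.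
      contract (\<delta>\<^bsub>R\<^esub> x\<^sub>2) (\<lambda>g s. \<phi> (\<pi> (s \<cdot>\<^bsub>R\<^esub> b)) \<odot>\<^bsub>R\<^esub> (x\<^sub>1 \<cdot>\<^bsub>R\<^esub> (g \<triangleright>\<^bsub>R\<^esub> a)))))"
    unfolding hit_def by (rule R.contract_comult_mult[OF bilinear_hit[OF \<phi>]])
  also have "\<dots> = contract (\<Delta>\<^bsub>R\<^esub> z) (\<lambda>a b. contract (\<Delta>\<^bsub>R\<^esub> x) (\<lambda>x\<^sub>1 x\<^sub>2. x\<^sub>1 \<cdot>\<^bsub>R\<^esub> twist \<phi> a b (\<pi> x\<^sub>2)))"
    by (subst contract_swap) (simp add: twist linear_contract[OF R.mult_linear_right])
  also have "\<dots> = contract (\<Delta>\<^bsub>R\<^esub> z) (\<lambda>a b. \<Sum>t\<in>I. hit (\<chi> t) x \<cdot>\<^bsub>R\<^esub> twist \<phi> a b t)"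
    by (intro contract_cong I bilinear_mapI vector_spaces)
      (simp_all add: linear_add[OF lin] linear_scale[OF lin])
  finally show ?thesis .
qed

lemma pr_mult_tail:
  assumes "x \<in> tail d" "i \<le> d"
  shows "R.gr.pr i (x \<cdot>\<^bsub>R\<^esub> y) = (if i = d then R.gr.pr d x \<cdot>\<^bsub>R\<^esub> R.gr.pr 0 y else 0)"
proof -
  have "R.gr.pr i (x \<cdot>\<^bsub>R\<^esub> y) = (\<Sum>j\<le>i. if j = d then R.gr.pr d x \<cdot>\<^bsub>R\<^esub> R.gr.pr 0 y else 0)"
    unfolding R.pr_mult by (rule sum.cong) (use assms in \<open>auto simp: tail_def\<close>)
  thus ?thesis using assms(2) by auto
qed

lemma filtration_mult:
  assumes x: "x \<in> filtration d"
  shows "x \<cdot>\<^bsub>R\<^esub> z \<in> filtration d"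
  unfolding filtration_def
proof (intro CollectI allI impI)
  fix \<phi> assume \<phi>: "functional \<phi>"
  obtain I \<chi> where \<chi>: "\<And>t. functional (\<chi> t)"
    and I: "\<And>B. bilinear_map (scalar R) (scalar T) (scalar R) B \<Longrightarrow>
      contract (\<Delta>\<^bsub>R\<^esub> x) (\<lambda>a b. B a (\<pi> b)) = (\<Sum>t\<in>I. B (hit (\<chi> t) x) t)"
    by (rule hit_expansion[of x]) blast
  have "hit (\<chi> t) x \<in> tail d" for t using x \<chi> by (simp add: filtration_def)
  thus "hit \<phi> (x \<cdot>\<^bsub>R\<^esub> z) \<in> tail d"
    by (simp add: tail_def hit_mult[OF \<phi> I] linear_contract[OF R.gr.linear_pr] linear_sum[OF R.gr.linear_pr]
        pr_mult_tail[of _ d, unfolded tail_def])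
qed

text \<open>
  This is \<open>f (x z) = f x (1 \<otimes> \<pi> z)\<close> for \<open>f x = coinv (pr d x\<^sub>1) \<otimes> \<pi> x\<^sub>2\<close>,
  contracted with \<open>\<phi>\<close>. The lowest-degree part of a product \<open>y q\<close> with \<open>y\<close> in \<open>tail d\<close> is
  \<open>pr d y\<close> times \<open>pr 0 q\<close>, so \<open>coinv\<close> only sees \<open>q\<close> through its counit. Applied to
  \<open>twist \<phi> a b t\<close> the counit removes the action of \<open>K\<close>.
\<close>
lemma coinv_hit_mult:
  assumes x: "x \<in> filtration d" and \<phi>: "functional \<phi>"
  shows "R.coinv (R.gr.pr d (hit \<phi> (x \<cdot>\<^bsub>R\<^esub> z))) = R.coinv (R.gr.pr d (hit (\<lambda>t. \<phi> (t \<cdot>\<^bsub>T\<^esub> \<pi> z)) x))"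
proof -
  obtain I \<chi> where \<chi>: "\<And>t. functional (\<chi> t)"
    and I: "\<And>B. bilinear_map (scalar R) (scalar T) (scalar R) B \<Longrightarrow>
      contract (\<Delta>\<^bsub>R\<^esub> x) (\<lambda>a b. B a (\<pi> b)) = (\<Sum>t\<in>I. B (hit (\<chi> t) x) t)"
    by (rule hit_expansion[of x]) blast
  define D where "D y = R.coinv (R.gr.pr d y)" for y
  have D: "Vector_Spaces.linear (scalar R) (scalar R) D"
    unfolding D_def[abs_def] by (rule linear_compose[OF R.gr.linear_pr R.linear_coinv])
  have D_mult: "D (y \<cdot>\<^bsub>R\<^esub> q) = \<epsilon>\<^bsub>R\<^esub> q \<odot>\<^bsub>R\<^esub> D y" if "y \<in> tail d" for y q
    using R.coinv_mult_degree_0[OF R.gr.pr_in, of "R.gr.pr d y" q] pr_mult_tail[OF that order.refl, of q]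
    by (simp add: D_def)
  have tail: "hit (\<chi> t) x \<in> tail d" for t using x \<chi> by (simp add: filtration_def)
  have \<epsilon>_twist: "\<epsilon>\<^bsub>R\<^esub> (twist \<phi> a b t) = \<epsilon>\<^bsub>R\<^esub> a * \<phi> (t \<cdot>\<^bsub>T\<^esub> \<pi> b)" for a b t
  proof -
    have "\<epsilon>\<^bsub>R\<^esub> (twist \<phi> a b t) = contract (\<delta>\<^bsub>T\<^esub> t) (\<lambda>g s. \<epsilon>\<^bsub>K\<^esub> g * (\<epsilon>\<^bsub>R\<^esub> a * \<phi> (s \<cdot>\<^bsub>T\<^esub> \<pi> b)))"
      by (simp add: twist_def linear_contract[OF R.counit_linear] R.counit_act mult_ac)
    also have "\<dots> = \<epsilon>\<^bsub>R\<^esub> a * \<phi> (t \<cdot>\<^bsub>T\<^esub> \<pi> b)"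
      by (intro T.contract_coact_counit linearI vector_spaces)
        (simp_all add: linear_add[OF \<phi>] linear_scale[OF \<phi>] algebra_simps)
    finally show ?thesis .
  qed
  have lin: "Vector_Spaces.linear (scalar R) (scalar R) (\<lambda>b. \<phi> (t \<cdot>\<^bsub>T\<^esub> \<pi> b) \<odot>\<^bsub>R\<^esub> y)" for t y
    by (intro linearI vector_spaces) (simp_all add: linear_add[OF \<phi>] linear_scale[OF \<phi>] R.vs.scale_left_distrib)
  have "D (hit \<phi> (x \<cdot>\<^bsub>R\<^esub> z)) = (\<Sum>t\<in>I. contract (\<Delta>\<^bsub>R\<^esub> z)
      (\<lambda>a b. \<epsilon>\<^bsub>R\<^esub> a \<odot>\<^bsub>R\<^esub> (\<phi> (t \<cdot>\<^bsub>T\<^esub> \<pi> b) \<odot>\<^bsub>R\<^esub> D (hit (\<chi> t) x))))"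
    by (simp add: hit_mult[OF \<phi> I] linear_contract[OF D] linear_sum[OF D] D_mult[OF tail] \<epsilon>_twist contract_sum)
  also have "\<dots> = (\<Sum>t\<in>I. \<phi> (t \<cdot>\<^bsub>T\<^esub> \<pi> z) \<odot>\<^bsub>R\<^esub> D (hit (\<chi> t) x))"
    by (intro sum.cong refl R.contract_counit_left lin)
  also have "\<dots> = D (\<Sum>t\<in>I. \<phi> (t \<cdot>\<^bsub>T\<^esub> \<pi> z) \<odot>\<^bsub>R\<^esub> hit (\<chi> t) x)"
    by (simp add: linear_sum[OF D] linear_scale[OF D])
  also have "(\<Sum>t\<in>I. \<phi> (t \<cdot>\<^bsub>T\<^esub> \<pi> z) \<odot>\<^bsub>R\<^esub> hit (\<chi> t) x) = hit (\<lambda>t. \<phi> (t \<cdot>\<^bsub>T\<^esub> \<pi> z)) x"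
    unfolding hit_def[of "\<lambda>t. \<phi> (t \<cdot>\<^bsub>T\<^esub> \<pi> z)"]
    by (intro I[symmetric] bilinear_mapI vector_spaces)
      (simp_all add: linear_add[OF \<phi>] linear_scale[OF \<phi>] R.vs.scale_left_distrib R.vs.scale_right_distrib
        mult.commute)
  finally show ?thesis by (simp add: D_def)
qed

end

section \<open>Counting dimensions\<close>

locale graded_braided_hopf_cover = graded_braided_hopf_map K R T \<pi>
  for K :: "('k::field, 'h::ab_group_add, 'm) hopf_data_scheme"
    and R :: "('k, 'h, 'a::ab_group_add, 'n) graded_yd_hopf_data_scheme"
    and T :: "('k, 'h, 'b::ab_group_add, 'o) graded_yd_hopf_data_scheme"
    and \<pi> :: "'a \<Rightarrow> 'b" +
  assumes surj: "surj \<pi>"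
    and bij_degree_0: "bij_betw \<pi> (component R 0) (component T 0)"
begin

text \<open>
  The degree \<open>0\<close> part of \<open>t\<close>, transported to \<open>R\<close> by the inverse of \<open>\<pi>\<close> in degree \<open>0\<close>. Thus the
  projection of \<open>x\<close> onto degree \<open>0\<close> is a function of \<open>\<pi> x\<close>, and \<open>hit_expansion\<close> applies to
  \<open>coinv x\<close>.
\<close>
definition lift_0 :: "'b \<Rightarrow> 'a" where
  "lift_0 t = the_inv_into (component R 0) \<pi> (T.gr.pr 0 t)"

lemma lift_0_map: "lift_0 (\<pi> x) = R.gr.pr 0 x"
  using bij_degree_0 R.gr.pr_in[of 0 x]
  by (simp add: lift_0_def map_pr[symmetric] the_inv_into_f_f bij_betw_def)

lemma linear_lift_0: "Vector_Spaces.linear (scalar T) (scalar R) lift_0"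
proof (rule linearI)
  show "lift_0 (t + t') = lift_0 t + lift_0 t'" for t t'
  proof -
    obtain x y where "t = \<pi> x" "t' = \<pi> y" using surj by (meson surjD)
    thus ?thesis using lift_0_map[of "x + y"] by (simp add: lift_0_map)
  qed
  show "lift_0 (c \<odot>\<^bsub>T\<^esub> t) = c \<odot>\<^bsub>R\<^esub> lift_0 t" for c t
  proof -
    obtain x where "t = \<pi> x" using surj by (meson surjD)
    thus ?thesis using lift_0_map[of "c \<odot>\<^bsub>R\<^esub> x"] by (simp add: lift_0_map)
  qed
qed (rule vector_spaces)+

lemmas lift_0_simps [simp] = linear_add[OF linear_lift_0] linear_scale[OF linear_lift_0]

lemma pr_lift_0: "R.gr.pr n (lift_0 t) = (if n = 0 then lift_0 t else 0)"
proof -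
  obtain x where "t = \<pi> x" using surj by (meson surjD)
  thus ?thesis by (simp add: lift_0_map)
qed

text \<open>
  The kernel of \<open>f x = coinv (pr d x\<^sub>1) \<otimes> \<pi> x\<^sub>2\<close>. Write \<open>y = hit \<phi> x\<close> as
  \<open>coinv(y\<^sub>1) p(y\<^sub>2)\<close>; the left factors \<open>coinv (hit \<chi> y) = coinv (hit (conv \<chi> \<phi>) x)\<close>
  have no component of degree \<open>d\<close>, and the right factors have degree \<open>0\<close>.
\<close>
lemma pr_hit_eq_0:
  assumes coinv: "\<And>\<phi>. functional \<phi> \<Longrightarrow> R.coinv (R.gr.pr d (hit \<phi> x)) = 0" and \<phi>: "functional \<phi>"
  shows "R.gr.pr d (hit \<phi> x) = 0"
proof -
  let ?y = "hit \<phi> x"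
  obtain I \<chi> where \<chi>: "\<And>t. functional (\<chi> t)"
    and I: "\<And>B. bilinear_map (scalar R) (scalar T) (scalar R) B \<Longrightarrow>
      contract (\<Delta>\<^bsub>R\<^esub> ?y) (\<lambda>a b. B a (\<pi> b)) = (\<Sum>t\<in>I. B (hit (\<chi> t) ?y) t)"
    by (rule hit_expansion[of ?y]) blast
  have "?y = contract (\<Delta>\<^bsub>R\<^esub> ?y) (\<lambda>a b. R.coinv a \<cdot>\<^bsub>R\<^esub> lift_0 (\<pi> b))"
    by (simp add: lift_0_map R.contract_coinv_pr_0)
  also have "\<dots> = (\<Sum>t\<in>I. R.coinv (hit (\<chi> t) ?y) \<cdot>\<^bsub>R\<^esub> lift_0 t)"
    by (intro I bilinear_mapI vector_spaces) simp_all
  finally have y: "?y = (\<Sum>t\<in>I. R.coinv (hit (\<chi> t) ?y) \<cdot>\<^bsub>R\<^esub> lift_0 t)" .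
  have "R.gr.pr d (R.coinv (hit (\<chi> t) ?y) \<cdot>\<^bsub>R\<^esub> lift_0 t) = 0" for t
  proof -
    have "R.gr.pr i (R.coinv (hit (\<chi> t) ?y)) \<cdot>\<^bsub>R\<^esub> R.gr.pr (d - i) (lift_0 t) = 0" if "i \<le> d" for i
    proof (cases "i = d")
      case True
      thus ?thesis
        using coinv[OF functional_conv[OF \<chi>[of t] \<phi>]] by (simp add: R.coinv_pr[symmetric] hit_hit \<chi> \<phi>)
    next
      case False
      thus ?thesis using that by (simp add: pr_lift_0)
    qed
    thus ?thesis by (simp add: R.pr_mult)
  qed
  hence "R.gr.pr d (\<Sum>t\<in>I. R.coinv (hit (\<chi> t) ?y) \<cdot>\<^bsub>R\<^esub> lift_0 t) = 0"
    by (simp add: linear_sum[OF R.gr.linear_pr])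
  thus ?thesis using y by simp
qed

lemma coinv_filtration:
  assumes u: "u \<in> filtration d"
  shows "R.coinv u \<in> filtration d"
proof -
  obtain I \<chi> where \<chi>: "\<And>t. functional (\<chi> t)"
    and I: "\<And>B. bilinear_map (scalar R) (scalar T) (scalar R) B \<Longrightarrow>
      contract (\<Delta>\<^bsub>R\<^esub> u) (\<lambda>a b. B a (\<pi> b)) = (\<Sum>t\<in>I. B (hit (\<chi> t) u) t)"
    by (rule hit_expansion[of u]) blast
  have "R.coinv u = contract (\<Delta>\<^bsub>R\<^esub> u) (\<lambda>a b. a \<cdot>\<^bsub>R\<^esub> \<S>\<^bsub>R\<^esub> (lift_0 (\<pi> b)))"
    by (simp add: R.coinv_def lift_0_map)
  also have "\<dots> = (\<Sum>t\<in>I. hit (\<chi> t) u \<cdot>\<^bsub>R\<^esub> \<S>\<^bsub>R\<^esub> (lift_0 t))"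
    by (intro I bilinear_mapI vector_spaces) simp_all
  also have "\<dots> \<in> filtration d"
    by (intro R.vs.subspace_sum[OF subspace_filtration] filtration_mult hit_filtration \<chi> u)
  finally show ?thesis .
qed

text \<open>
  This is \<open>f (coinv u r) = coinv u \<otimes> \<pi> r\<close>, contracted with \<open>\<phi>\<close>. Since
  \<open>coinv u r = u\<^sub>1 (S(p u\<^sub>2) r)\<close> with left factors in the filtration, \<open>coinv_hit_mult\<close>
  gives \<open>coinv (pr d u\<^sub>1) \<otimes> \<pi>(u\<^sub>2 S(p u\<^sub>3) r)\<close>. As \<open>u\<close> has degree \<open>d\<close>, the projection of
  the left factor to degree \<open>d\<close> forces \<open>u\<^sub>2\<close> and \<open>u\<^sub>3\<close> into degree \<open>0\<close>, where \<open>u\<^sub>2 S(u\<^sub>3)\<close>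
  collapses to the counit.
\<close>
lemma coinv_hit_coinv_mult:
  assumes u: "u \<in> filtration d" "u \<in> component R d" and \<phi>: "functional \<phi>"
  shows "R.coinv (R.gr.pr d (hit \<phi> (R.coinv u \<cdot>\<^bsub>R\<^esub> r))) = \<phi> (\<pi> r) \<odot>\<^bsub>R\<^esub> R.coinv u"
proof -
  obtain I \<chi> where \<chi>: "\<And>t. functional (\<chi> t)"
    and I: "\<And>B. bilinear_map (scalar R) (scalar T) (scalar R) B \<Longrightarrow>
      contract (\<Delta>\<^bsub>R\<^esub> u) (\<lambda>a b. B a (\<pi> b)) = (\<Sum>t\<in>I. B (hit (\<chi> t) u) t)"
    by (rule hit_expansion[of u]) blast
  define D where "D y = R.coinv (R.gr.pr d y)" for y
  have D: "Vector_Spaces.linear (scalar R) (scalar R) D"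
    unfolding D_def[abs_def] by (rule linear_compose[OF R.gr.linear_pr R.linear_coinv])
  define \<theta> where "\<theta> s z = \<phi> (s \<cdot>\<^bsub>T\<^esub> \<pi> z)" for s z
  have \<theta>: "functional (\<lambda>s. \<theta> s z)" for z
    unfolding \<theta>_def by (intro linear_compose[OF T.mult_linear_left \<phi>])
  have [simp]: "\<theta> (s + s') z = \<theta> s z + \<theta> s' z" "\<theta> (c \<odot>\<^bsub>T\<^esub> s) z = c * \<theta> s z"
    "\<theta> s (z + z') = \<theta> s z + \<theta> s z'" "\<theta> s (c \<odot>\<^bsub>R\<^esub> z) = c * \<theta> s z" for s s' z z' c
    by (simp_all add: \<theta>_def linear_add[OF \<phi>] linear_scale[OF \<phi>])
  define \<Psi> where "\<Psi> c = \<phi> (\<pi> (R.coinv c \<cdot>\<^bsub>R\<^esub> r))" for c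
  have lin_\<Psi>: "Vector_Spaces.linear (scalar R) (*) \<Psi>"
    unfolding \<Psi>_def
    by (intro linear_compose[OF R.linear_coinv] linear_compose[OF R.mult_linear_left] linear_compose[OF map_linear] \<phi>)
  have \<Psi>: "contract (\<Delta>\<^bsub>R\<^esub> c) (\<lambda>b b'. \<theta> (\<pi> b) (\<S>\<^bsub>R\<^esub> (R.gr.pr 0 b') \<cdot>\<^bsub>R\<^esub> r)) = \<Psi> c" for c
    by (simp add: \<Psi>_def \<theta>_def R.coinv_def linear_contract[OF R.mult_linear_left]
        linear_contract[OF map_linear] linear_contract[OF \<phi>] T.mult_assoc)
  have scale: "Vector_Spaces.linear (*) (scalar R) (\<lambda>c. c \<odot>\<^bsub>R\<^esub> a)" for a
    by (intro linearI vector_spaces) (simp_all add: R.vs.scale_left_distrib)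
  have "R.coinv u \<cdot>\<^bsub>R\<^esub> r = contract (\<Delta>\<^bsub>R\<^esub> u) (\<lambda>a b. a \<cdot>\<^bsub>R\<^esub> (\<S>\<^bsub>R\<^esub> (lift_0 (\<pi> b)) \<cdot>\<^bsub>R\<^esub> r))"
    by (simp add: R.coinv_def lift_0_map linear_contract[OF R.mult_linear_left] R.mult_assoc)
  also have "\<dots> = (\<Sum>t\<in>I. hit (\<chi> t) u \<cdot>\<^bsub>R\<^esub> (\<S>\<^bsub>R\<^esub> (lift_0 t) \<cdot>\<^bsub>R\<^esub> r))"
    by (intro I bilinear_mapI vector_spaces) simp_all
  finally have "D (hit \<phi> (R.coinv u \<cdot>\<^bsub>R\<^esub> r))
      = (\<Sum>t\<in>I. D (hit \<phi> (hit (\<chi> t) u \<cdot>\<^bsub>R\<^esub> (\<S>\<^bsub>R\<^esub> (lift_0 t) \<cdot>\<^bsub>R\<^esub> r))))"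
    by (simp add: linear_sum[OF linear_hit[OF \<phi>]] linear_sum[OF D])
  also have "\<dots> = (\<Sum>t\<in>I. D (hit (\<lambda>s. \<theta> s (\<S>\<^bsub>R\<^esub> (lift_0 t) \<cdot>\<^bsub>R\<^esub> r)) (hit (\<chi> t) u)))"
    unfolding D_def \<theta>_def by (intro sum.cong refl coinv_hit_mult hit_filtration u \<chi> \<phi>)
  also have "\<dots> = D (\<Sum>t\<in>I. hit (\<lambda>s. \<theta> s (\<S>\<^bsub>R\<^esub> (lift_0 t) \<cdot>\<^bsub>R\<^esub> r)) (hit (\<chi> t) u))"
    by (simp add: linear_sum[OF D])
  also have "(\<Sum>t\<in>I. hit (\<lambda>s. \<theta> s (\<S>\<^bsub>R\<^esub> (lift_0 t) \<cdot>\<^bsub>R\<^esub> r)) (hit (\<chi> t) u))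
      = contract (\<Delta>\<^bsub>R\<^esub> u) (\<lambda>a b. hit (\<lambda>s. \<theta> s (\<S>\<^bsub>R\<^esub> (lift_0 (\<pi> b)) \<cdot>\<^bsub>R\<^esub> r)) a)"
    by (intro I[symmetric] bilinear_mapI vector_spaces)
      (simp_all add: linear_add[OF linear_hit[OF \<theta>]] linear_scale[OF linear_hit[OF \<theta>]] hit_add hit_scale)
  also have "\<dots> = contract (\<Delta>\<^bsub>R\<^esub> u) (\<lambda>c b. contract (\<Delta>\<^bsub>R\<^esub> c)
      (\<lambda>a a'. \<theta> (\<pi> a') (\<S>\<^bsub>R\<^esub> (R.gr.pr 0 b) \<cdot>\<^bsub>R\<^esub> r) \<odot>\<^bsub>R\<^esub> a))"
    by (simp add: hit_def lift_0_map)
  also have "\<dots> = contract (\<Delta>\<^bsub>R\<^esub> u) (\<lambda>a c. contract (\<Delta>\<^bsub>R\<^esub> c)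
      (\<lambda>b b'. \<theta> (\<pi> b) (\<S>\<^bsub>R\<^esub> (R.gr.pr 0 b') \<cdot>\<^bsub>R\<^esub> r) \<odot>\<^bsub>R\<^esub> a))"
    by (intro R.contract_comult_coassoc[where w = "scalar R"] linearI vector_spaces)
      (simp_all add: R.vs.scale_left_distrib R.vs.scale_right_distrib R.vs.scale_left_commute)
  also have "\<dots> = contract (\<Delta>\<^bsub>R\<^esub> u) (\<lambda>a c. \<Psi> c \<odot>\<^bsub>R\<^esub> a)"
    by (simp add: linear_contract[OF scale, symmetric] \<Psi>)
  also have "D \<dots> = R.coinv (contract (\<Delta>\<^bsub>R\<^esub> (R.gr.pr d u)) (\<lambda>a c. \<Psi> c \<odot>\<^bsub>R\<^esub> R.gr.pr d a))"
    using u(2) by (simp add: D_def linear_contract[OF R.gr.linear_pr] R.gr.in_component_iff)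
  also have "contract (\<Delta>\<^bsub>R\<^esub> (R.gr.pr d u)) (\<lambda>a c. \<Psi> c \<odot>\<^bsub>R\<^esub> R.gr.pr d a)
      = (\<Sum>i\<le>d. contract (\<Delta>\<^bsub>R\<^esub> u) (\<lambda>a c. \<Psi> (R.gr.pr (d - i) c) \<odot>\<^bsub>R\<^esub> R.gr.pr d (R.gr.pr i a)))"
    by (intro R.contract_comult_pr[where w = "scalar R"] bilinear_mapI vector_spaces)
      (simp_all add: linear_add[OF lin_\<Psi>] linear_scale[OF lin_\<Psi>] R.vs.scale_left_distrib
        R.vs.scale_right_distrib mult.commute)
  also have "\<dots> = (\<Sum>i\<le>d. if i = d then contract (\<Delta>\<^bsub>R\<^esub> u)
      (\<lambda>a c. \<epsilon>\<^bsub>R\<^esub> c \<odot>\<^bsub>R\<^esub> (\<phi> (\<pi> r) \<odot>\<^bsub>R\<^esub> R.gr.pr d a)) else 0)"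
    by (rule sum.cong) (auto simp: \<Psi>_def R.coinv_pr_0 linear_scale[OF \<phi>] map_one)
  also have "\<dots> = contract (\<Delta>\<^bsub>R\<^esub> u) (\<lambda>a c. \<epsilon>\<^bsub>R\<^esub> c \<odot>\<^bsub>R\<^esub> (\<phi> (\<pi> r) \<odot>\<^bsub>R\<^esub> R.gr.pr d a))"
    by simp
  also have "\<dots> = \<phi> (\<pi> r) \<odot>\<^bsub>R\<^esub> R.gr.pr d u"
    by (intro R.contract_counit_right linearI vector_spaces)
      (simp_all add: R.vs.scale_right_distrib R.vs.scale_left_commute)
  also have "R.gr.pr d u = u" using u(2) by (simp add: R.gr.in_component_iff)
  finally show ?thesis by (simp add: D_def)
qed

lemma filtration_degree_less: "n < d \<Longrightarrow> filtration d \<inter> component R n \<subseteq> {0}"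
  using filtration_tail by (fastforce simp: tail_def R.gr.in_component_iff)

text \<open>
  The space \<open>V d\<close> of coinvariants in the lowest degree of \<open>filtration d\<close>.
\<close>
definition layer :: "nat \<Rightarrow> 'a set" where
  "layer d = R.coinv ` (filtration d \<inter> component R d)"

text \<open>
  In degree \<open>d + m\<close> the quotient of consecutive steps of the filtration is \<open>layer d \<otimes> T\<^sub>m\<close>. A
  basis of \<open>T\<^sub>m\<close> and its coordinate functionals split this tensor product into copies of
  \<open>layer d\<close>, and \<open>dim_joint_kernel\<close> applies.
\<close>
lemma dim_filtration_step:
  assumes "locally_finite R" "locally_finite T"
  shows "R.vs.dim (filtration d \<inter> component R (d + m))
    = R.vs.dim (filtration (Suc d) \<inter> component R (d + m)) + T.vs.dim (component T m) * R.vs.dim (layer d)"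
proof -
  let ?n = "d + m"
  let ?G = "filtration d \<inter> component R ?n"
  obtain X where X: "finite X" "component T m \<subseteq> T.vs.span X"
    using assms(2) unfolding locally_finite_def by blast
  obtain B \<chi> where B: "finite B" "B \<subseteq> component T m" "card B = T.vs.dim (component T m)"
    and \<chi>: "\<And>b. functional (\<chi> b)"
    and dual: "\<And>b b'. b \<in> B \<Longrightarrow> b' \<in> B \<Longrightarrow> \<chi> b b' = (if b = b' then 1 else 0)"
    and expand: "\<And>t. t \<in> component T m \<Longrightarrow> t = (\<Sum>b\<in>B. \<chi> b t \<odot>\<^bsub>T\<^esub> b)"
    by (rule basis_dual_system[OF T.vs.vector_space_axioms X]) (rule that)
  define D where "D y = R.coinv (R.gr.pr d y)" for y
  have D: "Vector_Spaces.linear (scalar R) (scalar R) D"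
    unfolding D_def[abs_def] by (rule linear_compose[OF R.gr.linear_pr R.linear_coinv])
  obtain Y where Y: "finite Y" "component R ?n \<subseteq> R.vs.span Y"
    using assms(1) unfolding locally_finite_def by blast
  have "R.vs.dim ?G = R.vs.dim {x \<in> ?G. \<forall>b\<in>B. D (hit (\<chi> b) x) = 0} + card B * R.vs.dim (layer d)"
  proof (rule dim_joint_kernel[OF B(1) _ R.vs.vector_space_axioms _ Y(1)])
    show "Vector_Spaces.linear (scalar R) (scalar R) (\<lambda>x. D (hit (\<chi> b) x))" for b
      by (rule linear_compose[OF linear_hit[OF \<chi>] D])
    show "R.vs.subspace ?G"
      by (intro R.vs.subspace_inter subspace_filtration R.component_subspace)
    show "?G \<subseteq> R.vs.span Y" using Y(2) by auto
    show "D (hit (\<chi> b) x) \<in> layer d" if "x \<in> ?G" for b x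
      using pr_filtration[OF hit_filtration[OF \<chi>[of b], of x d]] that R.gr.pr_in by (auto simp: D_def layer_def)
    fix b v assume b: "b \<in> B" and "v \<in> layer d"
    then obtain u where u: "u \<in> filtration d" "u \<in> component R d" and v: "v = R.coinv u"
      by (auto simp: layer_def)
    obtain r where "\<pi> r = b" using surj by (metis surjD)
    hence r: "\<pi> (R.gr.pr m r) = b"
      using b B(2) by (auto simp: map_pr T.gr.in_component_iff)
    let ?x = "R.coinv u \<cdot>\<^bsub>R\<^esub> R.gr.pr m r"
    have "R.coinv u \<in> component R d"
      using u(2) by (simp add: R.gr.in_component_iff R.coinv_pr[symmetric])
    hence "?x \<in> ?G"
      using R.component_mult[OF _ R.gr.pr_in] filtration_mult[OF coinv_filtration[OF u(1)]] by blast
    moreover have "D (hit (\<chi> b') ?x) = (if b' = b then v else 0)" if "b' \<in> B" for b'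
      using coinv_hit_coinv_mult[OF u \<chi>[of b'], of "R.gr.pr m r"] dual[OF that b] r v by (simp add: D_def)
    ultimately show "\<exists>x\<in>?G. D (hit (\<chi> b) x) = v \<and> (\<forall>b'\<in>B - {b}. D (hit (\<chi> b') x) = 0)"
      using b by (intro bexI[of _ ?x]) auto
  qed
  also have "{x \<in> ?G. \<forall>b\<in>B. D (hit (\<chi> b) x) = 0} = filtration (Suc d) \<inter> component R ?n"
  proof (intro equalityI subsetI)
    fix x assume "x \<in> filtration (Suc d) \<inter> component R ?n"
    thus "x \<in> {x \<in> ?G. \<forall>b\<in>B. D (hit (\<chi> b) x) = 0}"
      using \<chi> by (simp add: filtration_Suc D_def)
  next
    fix x assume x: "x \<in> {x \<in> ?G. \<forall>b\<in>B. D (hit (\<chi> b) x) = 0}"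
    \<comment> \<open>For \<open>x\<close> of degree \<open>d + m\<close>, the degree \<open>d\<close> part of \<open>hit \<phi> x\<close> depends only on \<open>\<phi>\<close> on
      \<open>T\<^sub>m\<close>, where \<open>\<phi>\<close> is a combination of the coordinates \<open>\<chi> b\<close>.\<close>
    have pr: "R.gr.pr d (hit \<phi> x) = R.gr.pr d (hit (\<lambda>t. \<phi> (T.gr.pr m t)) x)" if "functional \<phi>" for \<phi>
      using pr_hit_pr[OF that, of d ?n x] x by (simp add: R.gr.in_component_iff)
    have "D (hit \<phi> x) = 0" if \<phi>: "functional \<phi>" for \<phi>
    proof -
      have eq: "\<phi> (T.gr.pr m t) = (\<Sum>b\<in>B. \<phi> b * \<chi> b (T.gr.pr m t))" for t
      proof -
        have "\<phi> (T.gr.pr m t) = \<phi> (\<Sum>b\<in>B. \<chi> b (T.gr.pr m t) \<odot>\<^bsub>T\<^esub> b)"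
          using expand[OF T.gr.pr_in] by simp
        thus ?thesis by (simp add: linear_sum[OF \<phi>] linear_scale[OF \<phi>] mult.commute)
      qed
      have "hit (\<lambda>t. \<phi> (T.gr.pr m t)) x = (\<Sum>b\<in>B. \<phi> b \<odot>\<^bsub>R\<^esub> hit (\<lambda>t. \<chi> b (T.gr.pr m t)) x)"
        unfolding eq hit_def
        by (simp add: R.vs.scale_sum_left contract_sum contract_scale[OF R.vs.vector_space_axioms, symmetric])
      hence "D (hit \<phi> x) = R.coinv (R.gr.pr d (\<Sum>b\<in>B. \<phi> b \<odot>\<^bsub>R\<^esub> hit (\<lambda>t. \<chi> b (T.gr.pr m t)) x))"
        by (simp only: D_def pr[OF \<phi>])
      also have "\<dots> = (\<Sum>b\<in>B. \<phi> b \<odot>\<^bsub>R\<^esub> D (hit (\<chi> b) x))"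
        by (simp add: linear_sum[OF R.gr.linear_pr] linear_sum[OF R.linear_coinv] D_def pr[OF \<chi>])
      also have "\<dots> = 0" using x by simp
      finally show ?thesis .
    qed
    hence "\<forall>\<phi>. functional \<phi> \<longrightarrow> R.gr.pr d (hit \<phi> x) = 0"
      using pr_hit_eq_0[of d x] by (simp add: D_def)
    thus "x \<in> filtration (Suc d) \<inter> component R ?n" using x by (simp add: filtration_Suc)
  qed
  finally show ?thesis by (simp add: B(3))
qed

lemma dim_component:
  assumes "locally_finite R" "locally_finite T"
  shows "R.vs.dim (component R n) = (\<Sum>d\<le>n. R.vs.dim (layer d) * T.vs.dim (component T (n - d)))"
proof -
  \<comment> \<open>The filtration of \<open>R\<^sub>n\<close> reaches \<open>0\<close> at step \<open>n + 1\<close>.\<close>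
  have "R.vs.dim (component R n)
      = R.vs.dim (filtration k \<inter> component R n) + (\<Sum>d<k. R.vs.dim (layer d) * T.vs.dim (component T (n - d)))"
    if "k \<le> Suc n" for k
    using that
  proof (induction k)
    case (Suc k)
    thus ?case using dim_filtration_step[OF assms, of k "n - k"] by simp
  qed (simp add: filtration_0)
  from this[of "Suc n"] have "R.vs.dim (component R n) = R.vs.dim (filtration (Suc n) \<inter> component R n)
      + (\<Sum>d\<le>n. R.vs.dim (layer d) * T.vs.dim (component T (n - d)))"
    by (simp add: lessThan_Suc_atMost)
  moreover have "R.vs.dim (filtration (Suc n) \<inter> component R n) = 0"
    using R.vs.dim_le_card[of "filtration (Suc n) \<inter> component R n" "{}"] filtration_degree_less[of n "Suc n"] by simp
  ultimately show ?thesis by simp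
qed

text \<open>
  The unit lies in degree \<open>0\<close> and is nonzero, having counit \<open>1\<close>. Hence the Hilbert series of \<open>T\<close>
  is a nonzero power series and can be cancelled.
\<close>
lemma dim_component_0_nonzero:
  assumes "locally_finite T"
  shows "T.vs.dim (component T 0) \<noteq> 0"
proof
  assume dim: "T.vs.dim (component T 0) = 0"
  obtain X where X: "finite X" "component T 0 \<subseteq> T.vs.span X"
    using assms unfolding locally_finite_def by blast
  obtain B where B: "B \<subseteq> component T 0" "T.vs.independent B" "component T 0 \<subseteq> T.vs.span B" "card B = 0"
    using T.vs.basis_exists dim by metis
  have "finite B" using T.vs.independent_span_bound[OF X(1) B(2)] B(1) X(2) by auto
  hence "component T 0 \<subseteq> {0}" using B by simp
  hence "\<one>\<^bsub>T\<^esub> = 0" using T.component_one by auto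
  thus False using T.counit_one by simp
qed

end

theorem proposition1p3:
  fixes K :: "('k::field, 'h::ab_group_add) hopf_data"
    and R :: "('k, 'h, 'a::ab_group_add) graded_yd_hopf_data"
    and T :: "('k, 'h, 'b::ab_group_add) graded_yd_hopf_data"
    and \<pi> :: "'a \<Rightarrow> 'b"
  assumes "hopf_algebra K" and "bij (antipode K)"
    and "graded_braided_hopf_algebra K R" and "graded_braided_hopf_algebra K T"
    and "graded_braided_hopf_map K R T \<pi>"
    and "surj \<pi>"
    and "bij_betw \<pi> (component R 0) (component T 0)"
    and "locally_finite R" and "locally_finite T"
  shows "\<exists>c :: nat \<Rightarrow> nat. hilbert_series R / hilbert_series T = Abs_fps (\<lambda>n. of_nat (c n))"
proof -
  interpret graded_braided_hopf_map K R T \<pi> by fact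
  interpret graded_braided_hopf_cover K R T \<pi>
    using assms(6,7) by unfold_locales
  define c where "c d = R.vs.dim (layer d)" for d
  have "hilbert_series R = Abs_fps (\<lambda>n. of_nat (c n)) * hilbert_series T"
    by (rule fps_ext)
      (simp add: hilbert_series_def fps_mult_nth atLeast0AtMost c_def dim_component[OF assms(8,9)])
  moreover have "fps_nth (hilbert_series T) 0 \<noteq> 0"
    using dim_component_0_nonzero[OF assms(9)] by (simp add: hilbert_series_def)
  hence "hilbert_series T \<noteq> 0" by auto
  ultimately have "hilbert_series R / hilbert_series T = Abs_fps (\<lambda>n. of_nat (c n))"
    by simp
  thus ?thesis by blast
qed

end
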